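(* Let $K$ be an algebraically closed field of arbitrary characteristic and $p\in K\langle x_1,\dots,x_m\rangle$ a multilinear polynomial which is trace vanishing on $M_3(K)$. Then $\operatorname{Im} p$ is one of: $\{0\}$; the set of scalar matrices; the set of $3$-scalar matrices; or a set with the property that for every triple $\lambda_1,\lambda_2,\lambda_3\in K$ with $\lambda_1+\lambda_2+\lambda_3=0$ there is a matrix $M\in\operatorname{Im} p$ with eigenvalues $\lambda_1,\lambda_2,\lambda_3$.
   Context: A polynomial is multilinear if it has the form $\sum_{\sigma\in S_m}c_\sigma x_{\sigma(1)}\cdots x_{\sigma(m)}$. $p$ is trace vanishing on $M_3(K)$ if all its values on $M_3(K)$ have trace $0$. Fix $\varepsilon$ a primitive cube root of $1$ if $\operatorname{char}K\ne3$, and $\varepsilon=1$ if $\operatorname{char}K=3$; a matrix is $3$-scalar if its eigenvalues are $\gamma,\gamma\varepsilon,\gamma\varepsilon^2$ for some $\gamma\in K$. *)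

theory Defs
  imports "HOL-Computational_Algebra.Polynomial" "Jordan_Normal_Form.Char_Poly"
begin

definition mat_trace :: "'a::comm_ring_1 mat \<Rightarrow> 'a" where
  "mat_trace A = (\<Sum>i<dim_row A. A $$ (i, i))"

text \<open>A multilinear polynomial in m variables x_0,...,x_(m-1) is given by its coefficient
  family c indexed by permutations sigma of {0..<m}:
  p = sum over sigma of c sigma * x_(sigma 0) * ... * x_(sigma (m-1)).
  Evaluation at n x n matrices X 0, ..., X (m-1).\<close>
definition ml_eval :: "nat \<Rightarrow> nat \<Rightarrow> ((nat \<Rightarrow> nat) \<Rightarrow> 'a::comm_ring_1) \<Rightarrow> (nat \<Rightarrow> 'a mat) \<Rightarrow> 'a mat" where
  "ml_eval n m c X = mat n n (\<lambda>(i, j).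
     \<Sum>\<sigma>\<in>{\<sigma>. \<sigma> permutes {0..<m}}.
        c \<sigma> * (foldr (\<lambda>k M. X (\<sigma> k) * M) [0..<m] (1\<^sub>m n)) $$ (i, j))"

definition ml_image :: "nat \<Rightarrow> nat \<Rightarrow> ((nat \<Rightarrow> nat) \<Rightarrow> 'a::comm_ring_1) \<Rightarrow> 'a mat set" where
  "ml_image n m c = {ml_eval n m c X | X. \<forall>i<m. X i \<in> carrier_mat n n}"

definition trace_vanishing :: "nat \<Rightarrow> nat \<Rightarrow> ((nat \<Rightarrow> nat) \<Rightarrow> 'a::comm_ring_1) \<Rightarrow> bool" where
  "trace_vanishing n m c \<longleftrightarrow> (\<forall>A\<in>ml_image n m c. mat_trace A = 0)"

definition has_eigenvalues3 :: "'a::comm_ring_1 mat \<Rightarrow> 'a \<Rightarrow> 'a \<Rightarrow> 'a \<Rightarrow> bool" where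
  "has_eigenvalues3 A l1 l2 l3 \<longleftrightarrow>
     char_poly A = [:- l1, 1:] * [:- l2, 1:] * [:- l3, 1:]"

definition eps3 :: "'a::field" where
  "eps3 = (if (3::'a) \<noteq> 0 then (SOME e. e ^ 3 = 1 \<and> e \<noteq> 1) else 1)"

definition three_scalar :: "'a::field mat \<Rightarrow> bool" where
  "three_scalar A \<longleftrightarrow> A \<in> carrier_mat 3 3 \<and>
     (\<exists>\<gamma>. has_eigenvalues3 A \<gamma> (\<gamma> * eps3) (\<gamma> * eps3 ^ 2))"

end

theory Submission
  imports Defs "HOL-Library.Numeral_Type"
begin

text \<open>
  Suppose that some value of p is not scalar. Conjugating and expanding in matrix units gives a
  tuple u of matrix units with p(u) a nonzero multiple of the unit at (0, 1). Grade M_3 by Z/3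
  through j - i. On tuples with the degrees of u the values of p are supported on the entries
  (i, i + 1), giving three multilinear forms f_0, f_1, f_2, permuted cyclically by relabelling the
  indices; f_0 does not vanish at u while f_1 and f_2 do. Hence f_0 and f_1 are not proportional in
  some slot, and by cyclic symmetry f_0, f_1, f_2 are pairwise non-proportional in that slot for
  generic arguments. There the determinant of p, which is f_0 f_1 f_2, has three distinct roots on
  a pencil of values; so its discriminant is nonzero for generic arguments in M_3 as well.

  Let q be the sum of the principal 2x2 minors. If q does not vanish identically on the image, take
  a pencil on which both q and that discriminant are nonzero: comparing root multiplicities of the
  binary forms q^3 and det^2 shows that all pairs (q, det) with q nonzero occur, and graded tuples
  give q = 0. If q vanishes identically, all values are 3-scalar; in characteristic 3 this is
  impossible, and otherwise every similarity class of 3-scalar matrices is represented by an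
  explicit value. Genericity means: polynomial functions that are nonzero somewhere are
  simultaneously nonzero at a point of the line joining two such points.
\<close>

section \<open>Evaluation on 3x3 matrices indexed by Z/3\<close>

lemma UNIV_3: "(UNIV :: 3 set) = {0, 1, 2}"
proof -
  have "x \<in> {0, 1, 2}" for x :: 3
  proof (cases x)
    case (of_int z)
    then have "z = 0 \<or> z = 1 \<or> z = 2" by auto
    with of_int show ?thesis by auto
  qed
  then show ?thesis by blast
qed

lemma exhaust_3: obtains "(x::3) = 0" | "x = 1" | "x = 2"
  using UNIV_3 by blast

lemma forall_3: "(\<forall>i::3. P i) \<longleftrightarrow> P 0 \<and> P 1 \<and> P 2"
  by (metis exhaust_3)

lemma sum_3: "(\<Sum>i\<in>UNIV. f (i::3)) = f 0 + f 1 + f 2"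
  unfolding UNIV_3 by (simp add: add.assoc)

text \<open>Indexing by the ring \<open>3\<close> turns degrees \<open>j - i\<close> and cyclic
  shifts \<open>i + 1\<close> into ring operations and avoids carrier conditions.\<close>

type_synonym 'a m3 = "3 \<Rightarrow> 3 \<Rightarrow> 'a"

definition mult3 :: "'a::comm_ring_1 m3 \<Rightarrow> 'a m3 \<Rightarrow> 'a m3" where
  "mult3 A B = (\<lambda>i j. \<Sum>k\<in>UNIV. A i k * B k j)"

definition one3 :: "'a::comm_ring_1 m3" where
  "one3 = (\<lambda>i j. if i = j then 1 else 0)"

definition tr3 :: "'a::comm_ring_1 m3 \<Rightarrow> 'a" where
  "tr3 A = A 0 0 + A 1 1 + A 2 2"

text \<open>The linear coefficient of the characteristic polynomial, i.e. the second elementary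
  symmetric function of the eigenvalues.\<close>

definition q3 :: "'a::comm_ring_1 m3 \<Rightarrow> 'a" where
  "q3 A = A 0 0 * A 1 1 - A 0 1 * A 1 0 + A 0 0 * A 2 2 - A 0 2 * A 2 0
     + A 1 1 * A 2 2 - A 1 2 * A 2 1"

definition det3 :: "'a::comm_ring_1 m3 \<Rightarrow> 'a" where
  "det3 A = A 0 0 * (A 1 1 * A 2 2 - A 1 2 * A 2 1)
     - A 0 1 * (A 1 0 * A 2 2 - A 1 2 * A 2 0)
     + A 0 2 * (A 1 0 * A 2 1 - A 1 1 * A 2 0)"

definition word3 :: "(nat \<Rightarrow> 'a::comm_ring_1 m3) \<Rightarrow> nat list \<Rightarrow> 'a m3" where
  "word3 X ks = foldr (\<lambda>k. mult3 (X k)) ks one3"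

definition ev3 :: "nat \<Rightarrow> ((nat \<Rightarrow> nat) \<Rightarrow> 'a::comm_ring_1) \<Rightarrow> (nat \<Rightarrow> 'a m3) \<Rightarrow> 'a m3" where
  "ev3 m c X = (\<lambda>i j. \<Sum>\<sigma> | \<sigma> permutes {0..<m}. c \<sigma> * word3 X (map \<sigma> [0..<m]) i j)"

lemma word3_simps [simp]:
  "word3 X [] = one3" "word3 X (k # ks) = mult3 (X k) (word3 X ks)"
  by (simp_all add: word3_def)

lemma word3_cong: "(\<And>k. k \<in> set ks \<Longrightarrow> X k = Y k) \<Longrightarrow> word3 X ks = word3 Y ks"
  by (induction ks) auto

lemma set_map_permutes: "\<sigma> permutes {0..<m} \<Longrightarrow> set (map \<sigma> [0..<m]) = {0..<m}"
  using permutes_image by fastforce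

lemma distinct_map_permutes: "\<sigma> permutes {0..<m} \<Longrightarrow> distinct (map \<sigma> [0..<m])"
  by (simp add: distinct_map permutes_inj_on)

text \<open>Only slots below \<open>m\<close> are read, so slot \<open>m\<close> is free to carry a
  second argument later.\<close>

lemma ev3_cong:
  assumes "\<And>k. k < m \<Longrightarrow> X k = Y k"
  shows "ev3 m c X = ev3 m c Y"
proof -
  have "word3 X (map \<sigma> [0..<m]) = word3 Y (map \<sigma> [0..<m])" if "\<sigma> permutes {0..<m}" for \<sigma>
    by (rule word3_cong) (use that assms set_map_permutes[OF that] in auto)
  then show ?thesis
    unfolding ev3_def by (intro ext sum.cong) auto
qed

text \<open>Distinctness puts slot \<open>k\<close> at exactly one position of the word.\<close>

lemma word3_linear:
  assumes "distinct ks" "k \<in> set ks"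
  shows "word3 (X(k := \<lambda>i j. a * A i j + b * B i j)) ks i j
    = a * word3 (X(k := A)) ks i j + b * word3 (X(k := B)) ks i j"
  using assms
proof (induction ks arbitrary: i)
  case Nil
  then show ?case by simp
next
  case (Cons l ks)
  show ?case
  proof (cases "l = k")
    case True
    have eq: "word3 (X(k := C)) ks = word3 X ks" for C
      using True Cons.prems by (intro word3_cong) auto
    show ?thesis
      unfolding True word3_simps eq fun_upd_same mult3_def sum_3 by (simp add: algebra_simps)
  next
    case False
    then have IH: "word3 (X(k := \<lambda>i j. a * A i j + b * B i j)) ks l' j
      = a * word3 (X(k := A)) ks l' j + b * word3 (X(k := B)) ks l' j" for l'
      using Cons.prems by (intro Cons.IH) simp_all
    have eq: "(X(k := C)) l = X l" for C
      using False by simp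
    show ?thesis
      unfolding word3_simps mult3_def sum_3 eq IH by (simp add: algebra_simps)
  qed
qed

lemma ev3_linear:
  assumes "k < m"
  shows "ev3 m c (X(k := \<lambda>i j. a * A i j + b * B i j)) i j
    = a * ev3 m c (X(k := A)) i j + b * ev3 m c (X(k := B)) i j"
proof -
  have "word3 (X(k := \<lambda>i j. a * A i j + b * B i j)) (map \<sigma> [0..<m]) i j
    = a * word3 (X(k := A)) (map \<sigma> [0..<m]) i j + b * word3 (X(k := B)) (map \<sigma> [0..<m]) i j"
    if "\<sigma> permutes {0..<m}" for \<sigma>
    by (rule word3_linear) (use assms that distinct_map_permutes set_map_permutes[OF that] in auto)
  then show ?thesis
    unfolding ev3_def
    by (simp add: sum_distrib_left sum.distrib algebra_simps)
qed

text \<open>A multiplicative unital map commutes with words, and a linear one with the sum over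
  permutations. The array \<open>L\<close> expresses linearity entrywise; conjugation and
  relabelling are the two instances.\<close>

lemma ev3_hom:
  assumes mult: "\<And>A B. \<phi> (mult3 A B) = mult3 (\<phi> A) (\<phi> B)"
    and one: "\<phi> one3 = one3"
    and lin: "\<And>A i j. \<phi> A i j = (\<Sum>k\<in>UNIV. \<Sum>l\<in>UNIV. L i j k l * A k l)"
  shows "ev3 m c (\<lambda>k. \<phi> (X k)) = \<phi> (ev3 m c X)"
proof -
  have w: "word3 (\<lambda>k. \<phi> (X k)) ks = \<phi> (word3 X ks)" for ks
    by (induction ks) (simp_all add: mult one)
  show ?thesis
    unfolding ev3_def w lin
    by (simp add: sum_3 sum_distrib_left sum.distrib algebra_simps)
qed

text \<open>A nonzero entry of a word comes from a path of nonzero entries from \<open>i\<close> to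
  \<open>j\<close>, along which the differences of \<open>h\<close> telescope. Every permutation
  uses each slot once, so the total is the same for all words. Weights in the integers and in Z/3
  are both used.\<close>

lemma ev3_graded:
  fixes h :: "3 \<Rightarrow> 'g::ab_group_add"
  assumes X: "\<And>k i j. k < m \<Longrightarrow> X k i j \<noteq> 0 \<Longrightarrow> h j - h i = w k"
    and nz: "ev3 m c X i j \<noteq> 0"
  shows "h j - h i = (\<Sum>k<m. w k)"
proof -
  have word: "h j - h i = sum_list (map w ks)"
    if "set ks \<subseteq> {0..<m}" "word3 X ks i j \<noteq> 0" for ks i
    using that
  proof (induction ks arbitrary: i)
    case Nil
    then show ?case by (simp add: one3_def split: if_splits)
  next
    case (Cons k ks)
    then have "(\<Sum>l\<in>UNIV. X k i l * word3 X ks l j) \<noteq> 0" by (simp add: mult3_def)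
    then obtain l where "X k i l * word3 X ks l j \<noteq> 0"
      by (rule sum.not_neutral_contains_not_neutral)
    then have "X k i l \<noteq> 0" "word3 X ks l j \<noteq> 0" by auto
    with Cons X[of k i l] have "h l - h i = w k" "h j - h l = sum_list (map w ks)" by auto
    then show ?case by (simp add: algebra_simps)
  qed
  from nz obtain \<sigma> where \<sigma>: "\<sigma> permutes {0..<m}" and "word3 X (map \<sigma> [0..<m]) i j \<noteq> 0"
    unfolding ev3_def by (auto elim!: sum.not_neutral_contains_not_neutral dest: mult_not_zero)
  with word[of "map \<sigma> [0..<m]" i] set_map_permutes[OF \<sigma>]
  have "h j - h i = sum_list (map w (map \<sigma> [0..<m]))" by auto
  also have "\<dots> = sum w (set (map \<sigma> [0..<m]))"
    using distinct_map_permutes[OF \<sigma>] sum.distinct_set_conv_list by metis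
  also have "\<dots> = (\<Sum>k<m. w k)"
    using set_map_permutes[OF \<sigma>] by (simp add: lessThan_atLeast0)
  finally show ?thesis .
qed

section \<open>Conjugation and relabelling of indices\<close>

definition conj3 :: "'a::comm_ring_1 m3 \<Rightarrow> 'a m3 \<Rightarrow> 'a m3 \<Rightarrow> 'a m3" where
  "conj3 S T A = mult3 (mult3 S A) T"

definition relabel :: "(3 \<Rightarrow> 3) \<Rightarrow> 'a m3 \<Rightarrow> 'a m3" where
  "relabel f A = (\<lambda>i j. A (f i) (f j))"

lemma mult3_assoc: "mult3 (mult3 A B) C = mult3 A (mult3 B C)"
  by (simp add: mult3_def sum_3 algebra_simps)

lemma mult3_one [simp]: "mult3 A one3 = A" "mult3 one3 A = A"
proof -
  have "mult3 A one3 i j = A i j" "mult3 one3 A j i = A j i" for i j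
    by (cases j rule: exhaust_3; simp add: mult3_def one3_def sum_3)+
  then show "mult3 A one3 = A" "mult3 one3 A = A" by (intro ext; simp)+
qed

lemma ev3_conj:
  assumes "mult3 S T = one3" "mult3 T S = one3"
  shows "ev3 m c (\<lambda>k. conj3 S T (X k)) = conj3 S T (ev3 m c X)"
proof (rule ev3_hom)
  fix A B
  show "conj3 S T (mult3 A B) = mult3 (conj3 S T A) (conj3 S T B)"
  proof -
    have "mult3 (conj3 S T A) (conj3 S T B) = mult3 S (mult3 A (mult3 (mult3 T S) (mult3 B T)))"
      by (simp only: conj3_def mult3_assoc)
    then show ?thesis
      by (simp only: assms(2) mult3_one conj3_def mult3_assoc)
  qed
next
  show "conj3 S T one3 = one3" using assms by (simp add: conj3_def)
next
  fix A i j
  show "conj3 S T A i j = (\<Sum>k\<in>UNIV. \<Sum>l\<in>UNIV. S i k * T l j * A k l)"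
    by (simp add: conj3_def mult3_def sum_3 algebra_simps)
qed

lemma ev3_relabel:
  assumes "bij f"
  shows "ev3 m c (\<lambda>k. relabel f (X k)) = relabel f (ev3 m c X)"
proof (rule ev3_hom)
  fix A B :: "'a m3"
  show "relabel f (mult3 A B) = mult3 (relabel f A) (relabel f B)"
    unfolding relabel_def mult3_def using assms
    by (intro ext sum.reindex_bij_betw[symmetric, of f])
next
  show "relabel f one3 = one3"
    using assms by (simp add: relabel_def one3_def inj_eq[OF bij_is_inj])
next
  fix A :: "'a m3" and i j
  show "relabel f A i j = (\<Sum>k\<in>UNIV. \<Sum>l\<in>UNIV. (if k = f i \<and> l = f j then 1 else 0) * A k l)"
    by (cases "f i" rule: exhaust_3; cases "f j" rule: exhaust_3) (simp_all add: relabel_def sum_3)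
qed

section \<open>Generic points and matrix units\<close>

lemma infinite_UNIV_alg_closed_field: "infinite (UNIV :: 'a::alg_closed_field set)"
proof
  assume fin: "finite (UNIV :: 'a set)"
  define p where "p = (\<Prod>a\<in>(UNIV :: 'a set). [:- a, 1:])"
  have "degree p = card (UNIV :: 'a set)"
    unfolding p_def by (subst degree_prod_eq_sum_degree) auto
  moreover have "card (UNIV :: 'a set) > 0"
    using fin by (simp add: card_gt_0_iff)
  \<comment> \<open>The polynomial \<open>p\<close> vanishes at every element, so
    \<open>p + 1\<close> is nonconstant without a root.\<close>
  ultimately have "degree (p + 1) > 0"
    by (subst degree_add_eq_left) auto
  then obtain x where "poly (p + 1) x = 0"
    using alg_closed_imp_poly_has_root by blast
  moreover have "poly p x = 0"
    unfolding p_def poly_prod using fin by (intro prod_zero) (auto intro!: bexI[of _ x])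
  ultimately show False by simp
qed

text \<open>Being polynomial along every line is all that the genericity argument needs, and it is
  stable under the ring operations.\<close>

definition line_poly :: "((nat \<Rightarrow> 'a m3) \<Rightarrow> 'a::comm_ring_1) \<Rightarrow> bool" where
  "line_poly f \<longleftrightarrow> (\<forall>X Y. \<exists>p. \<forall>t. f (\<lambda>k i j. X k i j + t * Y k i j) = poly p t)"

definition line_closed :: "(nat \<Rightarrow> 'a::comm_ring_1 m3) set \<Rightarrow> bool" where
  "line_closed G \<longleftrightarrow> (\<forall>X\<in>G. \<forall>Y\<in>G. \<forall>t. (\<lambda>k i j. X k i j + t * (Y k i j - X k i j)) \<in> G)"

lemma line_closed_UNIV [simp]: "line_closed UNIV"
  by (simp add: line_closed_def)

lemma line_poly_const: "line_poly (\<lambda>X. a)"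
  unfolding line_poly_def by (auto intro: exI[of _ "[:a:]"])

lemma line_poly_entry: "line_poly (\<lambda>X. X k i j)"
  unfolding line_poly_def
proof (intro allI)
  fix X Y :: "nat \<Rightarrow> 'a m3"
  show "\<exists>p. \<forall>t. X k i j + t * Y k i j = poly p t"
    by (rule exI[of _ "[:X k i j, Y k i j:]"]) simp
qed

lemma line_poly_add:
  assumes "line_poly f" "line_poly g"
  shows "line_poly (\<lambda>X. f X + g X)"
  using assms unfolding line_poly_def by (metis poly_add)

lemma line_poly_diff:
  assumes "line_poly f" "line_poly g"
  shows "line_poly (\<lambda>X. f X - g X)"
  using assms unfolding line_poly_def by (metis poly_diff)

lemma line_poly_mult:
  assumes "line_poly f" "line_poly g"
  shows "line_poly (\<lambda>X. f X * g X)"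
  using assms unfolding line_poly_def by (metis poly_mult)

lemma line_poly_power: "line_poly f \<Longrightarrow> line_poly (\<lambda>X. f X ^ n)"
  by (induction n) (simp_all add: line_poly_const line_poly_mult)

lemma line_poly_sum: "(\<And>a. a \<in> S \<Longrightarrow> line_poly (f a)) \<Longrightarrow> line_poly (\<lambda>X. \<Sum>a\<in>S. f a X)"
  by (induction S rule: infinite_finite_induct) (simp_all add: line_poly_const line_poly_add)

lemma line_poly_prod: "(\<And>a. a \<in> S \<Longrightarrow> line_poly (f a)) \<Longrightarrow> line_poly (\<lambda>X. \<Prod>a\<in>S. f a X)"
  by (induction S rule: infinite_finite_induct) (simp_all add: line_poly_const line_poly_mult)

lemma line_poly_ev3: "line_poly (\<lambda>X. ev3 m c X i j)"
proof -
  have "line_poly (\<lambda>X. word3 X ks i j)" for ks i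
    by (induction ks arbitrary: i)
      (simp_all add: mult3_def line_poly_const line_poly_sum line_poly_mult line_poly_entry)
  then show ?thesis
    unfolding ev3_def by (intro line_poly_sum line_poly_mult line_poly_const)
qed

lemma line_poly_reindex:
  assumes "line_poly f"
  shows "line_poly (\<lambda>X. f (\<lambda>k. X (r k)))"
  unfolding line_poly_def
proof (intro allI)
  fix X Y :: "nat \<Rightarrow> 'a m3"
  show "\<exists>p. \<forall>t. f (\<lambda>k i j. X (r k) i j + t * Y (r k) i j) = poly p t"
    using assms[unfolded line_poly_def, rule_format, of "\<lambda>k. X (r k)" "\<lambda>k. Y (r k)"] .
qed

text \<open>Freezing the slots from \<open>n\<close> on at \<open>U\<close> amounts to giving them
  direction zero, so a line is still mapped to a line.\<close>

lemma line_poly_mix: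
  assumes "line_poly f"
  shows "line_poly (\<lambda>X. f (\<lambda>k. if k < n then X k else U k))"
  unfolding line_poly_def
proof (intro allI)
  fix X Y :: "nat \<Rightarrow> 'a m3"
  have eq: "(\<lambda>k. if k < n then \<lambda>i j. X k i j + t * Y k i j else U k)
    = (\<lambda>k i j. (if k < n then X k else U k) i j + t * (if k < n then Y k else (\<lambda>i j. 0)) i j)" for t
    by auto
  show "\<exists>p. \<forall>t. f (\<lambda>k. if k < n then \<lambda>i j. X k i j + t * Y k i j else U k) = poly p t"
    unfolding eq
    using assms[unfolded line_poly_def, rule_format, of "\<lambda>k. if k < n then X k else U k"
        "\<lambda>k. if k < n then Y k else (\<lambda>i j. 0)"] .
qed

lemmas line_poly_intros = line_poly_const line_poly_add line_poly_diff line_poly_mult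
  line_poly_power line_poly_ev3

text \<open>On the line joining \<open>X\<close> and \<open>Y\<close> both functions become
  polynomials in the parameter, nonzero at 0 and at 1 respectively. Their product has finitely many
  roots in an infinite field, and the line stays in \<open>G\<close>.\<close>

lemma line_poly_nonzero:
  fixes f g :: "(nat \<Rightarrow> 'a::alg_closed_field m3) \<Rightarrow> 'a"
  assumes f: "line_poly f" and g: "line_poly g" and G: "line_closed G"
    and XY: "X \<in> G" "Y \<in> G" and nz: "f X \<noteq> 0" "g Y \<noteq> 0"
  obtains Z where "Z \<in> G" "f Z \<noteq> 0" "g Z \<noteq> 0"
proof -
  define Z where "Z = (\<lambda>t k i j. X k i j + t * (Y k i j - X k i j))"
  obtain p where p: "\<And>t. f (Z t) = poly p t"
    using f unfolding line_poly_def Z_def by meson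
  obtain q where q: "\<And>t. g (Z t) = poly q t"
    using g unfolding line_poly_def Z_def by meson
  have "Z 0 = X" "Z 1 = Y" by (simp_all add: Z_def)
  with p q nz have "poly p 0 \<noteq> 0" "poly q 1 \<noteq> 0" by metis+
  then have "p * q \<noteq> 0" by auto
  then have "finite {t. poly (p * q) t = 0}" by (rule poly_roots_finite)
  then have "{t. poly (p * q) t = 0} \<noteq> UNIV"
    using infinite_UNIV_alg_closed_field by metis
  then obtain t where "poly p t \<noteq> 0" "poly q t \<noteq> 0" by auto
  moreover have "Z t \<in> G"
    using G XY unfolding line_closed_def Z_def by blast
  ultimately show thesis using that p q by metis
qed

section \<open>Values at tuples of matrix units\<close>

definition unit3 :: "3 \<Rightarrow> 3 \<Rightarrow> 'a::comm_ring_1 m3" where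
  "unit3 a b = (\<lambda>i j. if i = a \<and> j = b then 1 else 0)"

lemma linear_zero_on_units:
  fixes g :: "'a::comm_ring_1 m3 \<Rightarrow> 'a"
  assumes lin: "\<And>a b A B. g (\<lambda>i j. a * A i j + b * B i j) = a * g A + b * g B"
    and "\<And>a b. g (unit3 a b) = 0"
  shows "g A = 0"
proof -
  have "g (\<lambda>i j. \<Sum>p\<in>S. A (fst p) (snd p) * unit3 (fst p) (snd p) i j) = 0"
    if "finite S" for S :: "(3 \<times> 3) set"
    using that
  proof (induction S)
    case empty
    then show ?case using lin[of 0 A 0 A] by simp
  next
    case (insert p S)
    then show ?case
      using lin[of "A (fst p) (snd p)" "unit3 (fst p) (snd p)" 1
          "\<lambda>i j. \<Sum>p\<in>S. A (fst p) (snd p) * unit3 (fst p) (snd p) i j"] assms(2)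
      by simp
  qed
  from this[of UNIV] have "g (\<lambda>i j. \<Sum>p\<in>UNIV. A (fst p) (snd p) * unit3 (fst p) (snd p) i j) = 0"
    by simp
  moreover have "(\<Sum>p\<in>UNIV. A (fst p) (snd p) * unit3 (fst p) (snd p) i j) = A i j" for i j
  proof -
    have "(\<Sum>p\<in>UNIV. A (fst p) (snd p) * unit3 (fst p) (snd p) i j)
      = (\<Sum>p\<in>UNIV. if p = (i, j) then A i j else 0)"
      by (rule sum.cong) (auto simp: unit3_def)
    then show ?thesis by simp
  qed
  ultimately show ?thesis by simp
qed

text \<open>Slots are replaced one at a time: as a function of the current slot the value of
  \<open>f\<close> is linear and nonzero at \<open>X n\<close>, hence nonzero at some matrix
  unit.\<close>

lemma ev3_unit_tuple:
  fixes f :: "'a::comm_ring_1 m3 \<Rightarrow> 'a"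
  assumes lin: "\<And>a b A B. f (\<lambda>i j. a * A i j + b * B i j) = a * f A + b * f B"
    and nz: "f (ev3 m c X) \<noteq> 0"
  obtains r s where "f (ev3 m c (\<lambda>k. unit3 (r k) (s k))) \<noteq> 0"
proof -
  have "\<exists>r s. f (ev3 m c (\<lambda>k. if k < n then unit3 (r k) (s k) else X k)) \<noteq> 0" if "n \<le> m" for n
    using that
  proof (induction n)
    case 0
    then show ?case using nz by simp
  next
    case (Suc n)
    then obtain r s where rs: "f (ev3 m c (\<lambda>k. if k < n then unit3 (r k) (s k) else X k)) \<noteq> 0"
      by auto
    define Y where "Y = (\<lambda>k. if k < n then unit3 (r k) (s k) else X k)"
    define g where "g A = f (ev3 m c (Y(n := A)))" for A
    have g_lin: "g (\<lambda>i j. a * A i j + b * B i j) = a * g A + b * g B" for a b A B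
    proof -
      have "ev3 m c (Y(n := \<lambda>i j. a * A i j + b * B i j))
        = (\<lambda>i j. a * ev3 m c (Y(n := A)) i j + b * ev3 m c (Y(n := B)) i j)"
        using Suc.prems by (intro ext ev3_linear) simp
      then show ?thesis by (simp only: g_def lin)
    qed
    have g_nz: "g (X n) \<noteq> 0"
    proof -
      have "Y(n := X n) = Y" by (rule ext) (simp add: Y_def)
      moreover have "f (ev3 m c Y) \<noteq> 0" using rs unfolding Y_def .
      ultimately show ?thesis by (simp only: g_def not_False_eq_True)
    qed
    have "\<exists>a b. g (unit3 a b) \<noteq> 0"
    proof (rule ccontr)
      assume "\<nexists>a b. g (unit3 a b) \<noteq> 0"
      then have "g (unit3 a b) = 0" for a b by blast
      from linear_zero_on_units[of g, OF g_lin this] have "g (X n) = 0" .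
      with g_nz show False ..
    qed
    then obtain a b where ab: "g (unit3 a b) \<noteq> 0" by blast
    have eq: "Y(n := unit3 a b)
      = (\<lambda>k. if k < Suc n then unit3 ((r(n := a)) k) ((s(n := b)) k) else X k)"
      by (rule ext) (auto simp: Y_def)
    show ?case
      by (rule exI[of _ "r(n := a)"], rule exI[of _ "s(n := b)"])
        (use ab in \<open>unfold g_def eq\<close>)
  qed
  from this[of m] obtain r s
    where "f (ev3 m c (\<lambda>k. if k < m then unit3 (r k) (s k) else X k)) \<noteq> 0" by auto
  moreover have "ev3 m c (\<lambda>k. if k < m then unit3 (r k) (s k) else X k)
    = ev3 m c (\<lambda>k. unit3 (r k) (s k))"
    by (rule ev3_cong) simp
  ultimately have "f (ev3 m c (\<lambda>k. unit3 (r k) (s k))) \<noteq> 0" by simp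
  then show thesis by (rule that)
qed

text \<open>For every integer weight \<open>h\<close>, a matrix unit in slot \<open>k\<close> is
  homogeneous of degree \<open>h (s k) - h (r k)\<close>. Hence all nonzero entries of the value
  share one weight difference.\<close>

lemma ev3_unit_tuple_weight:
  assumes "ev3 m c (\<lambda>k. unit3 (r k) (s k)) i j \<noteq> 0" "ev3 m c (\<lambda>k. unit3 (r k) (s k)) a b \<noteq> 0"
  shows "h b - h a = h j - (h i :: int)"
proof -
  have "h j - h i = (\<Sum>k<m. h (s k) - h (r k))"
    if "ev3 m c (\<lambda>k. unit3 (r k) (s k)) i j \<noteq> 0" for i j
    by (rule ev3_graded[OF _ that]) (simp add: unit3_def split: if_splits)
  with assms show ?thesis by metis
qed

lemma ev3_unit_tuple_offdiag:
  assumes "ev3 m c (\<lambda>k. unit3 (r k) (s k)) 0 1 \<noteq> 0" "(i, j) \<noteq> (0, 1)"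
  shows "ev3 m c (\<lambda>k. unit3 (r k) (s k)) i j = 0"
proof (rule ccontr)
  assume nz: "ev3 m c (\<lambda>k. unit3 (r k) (s k)) i j \<noteq> 0"
  \<comment> \<open>The indicator of 0 has difference -1 at position (0, 1), which forces row 0; the
    indicator of 1 likewise forces column 1.\<close>
  have "i = 0"
    using ev3_unit_tuple_weight[OF assms(1) nz, of "\<lambda>x. if x = 0 then 1 else 0"]
    by (auto split: if_splits)
  moreover have "j = 1"
    using ev3_unit_tuple_weight[OF assms(1) nz, of "\<lambda>x. if x = 1 then 1 else 0"]
    by (auto split: if_splits)
  ultimately show False using assms(2) by simp
qed

text \<open>A diagonal position has difference zero for every weight, whereas the indicator of
  \<open>i\<close> separates \<open>i\<close> from \<open>j\<close>.\<close>

lemma ev3_unit_tuple_diag: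
  assumes "ev3 m c (\<lambda>k. unit3 (r k) (s k)) a a \<noteq> 0" "i \<noteq> j"
  shows "ev3 m c (\<lambda>k. unit3 (r k) (s k)) i j = 0"
proof (rule ccontr)
  assume nz: "ev3 m c (\<lambda>k. unit3 (r k) (s k)) i j \<noteq> 0"
  show False
    using ev3_unit_tuple_weight[OF assms(1) nz, of "\<lambda>x. if x = i then 1 else 0"] assms(2)
    by (auto split: if_splits)
qed

lemma transvection_inverse:
  assumes "i \<noteq> j"
  shows "mult3 (\<lambda>a b. one3 a b + unit3 i j a b) (\<lambda>a b. one3 a b - unit3 i j a b) = one3"
    and "mult3 (\<lambda>a b. one3 a b - unit3 i j a b) (\<lambda>a b. one3 a b + unit3 i j a b) = one3"
proof -
  have z: "unit3 i j a k * unit3 i j k b = 0" for a b k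
    using assms by (auto simp: unit3_def)
  have "mult3 (\<lambda>a b. one3 a b + unit3 i j a b) (\<lambda>a b. one3 a b - unit3 i j a b) a b
    = mult3 one3 one3 a b - mult3 one3 (unit3 i j) a b + mult3 (unit3 i j) one3 a b
      - (\<Sum>k\<in>UNIV. unit3 i j a k * unit3 i j k b)" for a b
    by (simp add: mult3_def sum_3 algebra_simps)
  then show "mult3 (\<lambda>a b. one3 a b + unit3 i j a b) (\<lambda>a b. one3 a b - unit3 i j a b) = one3"
    by (intro ext) (simp add: z)
  have "mult3 (\<lambda>a b. one3 a b - unit3 i j a b) (\<lambda>a b. one3 a b + unit3 i j a b) a b
    = mult3 one3 one3 a b + mult3 one3 (unit3 i j) a b - mult3 (unit3 i j) one3 a b
      - (\<Sum>k\<in>UNIV. unit3 i j a k * unit3 i j k b)" for a b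
    by (simp add: mult3_def sum_3 algebra_simps)
  then show "mult3 (\<lambda>a b. one3 a b - unit3 i j a b) (\<lambda>a b. one3 a b + unit3 i j a b) = one3"
    by (intro ext) (simp add: z)
qed

lemma ev3_conj_transvection:
  assumes "i \<noteq> j"
  shows "\<exists>Y. ev3 m c Y = conj3 (\<lambda>a b. one3 a b + unit3 i j a b) (\<lambda>a b. one3 a b - unit3 i j a b) (ev3 m c X)"
  by (rule exI, rule ev3_conj[OF transvection_inverse[OF assms]])

lemma ev3_offdiag_move:
  assumes "ev3 m c X i j \<noteq> 0" "i \<noteq> j"
  shows "\<exists>Y. ev3 m c Y 0 1 \<noteq> 0"
proof -
  \<comment> \<open>The affine map of Z/3 that sends 0 to \<open>i\<close> and 1 to
    \<open>j\<close>.\<close>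
  define f where "f x = i + x * (j - i)" for x
  have "inj f"
    using \<open>i \<noteq> j\<close> unfolding inj_def forall_3 f_def
    by (cases i rule: exhaust_3; cases j rule: exhaust_3) simp_all
  then have "bij f" by (simp add: bij_def finite_UNIV_inj_surj)
  from ev3_relabel[OF this, of m c X] have "ev3 m c (\<lambda>k. relabel f (X k)) 0 1 = ev3 m c X i j"
    by (simp add: relabel_def f_def)
  with assms(1) show ?thesis by (intro exI[of _ "\<lambda>k. relabel f (X k)"]) simp
qed

lemma ev3_nonscalar:
  assumes "\<nexists>a. ev3 m c X = (\<lambda>i j. a * one3 i j)"
  shows "\<exists>Y. ev3 m c Y 0 1 \<noteq> 0"
proof (cases "\<exists>i j. i \<noteq> j \<and> ev3 m c X i j \<noteq> 0")
  case True
  then obtain i j where "ev3 m c X i j \<noteq> 0" "i \<noteq> j" by blast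
  then show ?thesis by (rule ev3_offdiag_move)
next
  case False
  then have off: "\<And>i j. i \<noteq> j \<Longrightarrow> ev3 m c X i j = 0" by blast
  have "\<exists>i. ev3 m c X i i \<noteq> ev3 m c X 0 0"
  proof (rule ccontr)
    assume "\<nexists>i. ev3 m c X i i \<noteq> ev3 m c X 0 0"
    with off have "ev3 m c X = (\<lambda>i j. ev3 m c X 0 0 * one3 i j)"
      by (intro ext) (auto simp: one3_def)
    with assms show False by blast
  qed
  then obtain i where i: "ev3 m c X i i \<noteq> ev3 m c X 0 0" by blast
  then have "0 \<noteq> i" by auto
  \<comment> \<open>Conjugating a diagonal value by the transvection puts the difference of the
    diagonal entries \<open>i\<close> and 0 at position (0, \<open>i\<close>).\<close>
  obtain Y where "ev3 m c Y = conj3 (\<lambda>a b. one3 a b + unit3 0 i a b)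
      (\<lambda>a b. one3 a b - unit3 0 i a b) (ev3 m c X)"
    using ev3_conj_transvection[OF \<open>0 \<noteq> i\<close>, of m c X] by (rule exE)
  then have "ev3 m c Y 0 i = ev3 m c X i i - ev3 m c X 0 0"
    using \<open>0 \<noteq> i\<close>
    by (cases i rule: exhaust_3) (simp_all add: conj3_def mult3_def one3_def unit3_def sum_3 off)
  with i have "ev3 m c Y 0 i \<noteq> 0" by simp
  then show ?thesis using \<open>0 \<noteq> i\<close> by (rule ev3_offdiag_move)
qed

section \<open>The grading by Z/3\<close>

text \<open>The unit at (\<open>i\<close>, \<open>j\<close>) has degree \<open>j - i\<close> in Z/3.
  All slots are constrained, so slot \<open>m\<close> too can carry an argument of prescribed
  degree.\<close>

definition graded_tuples :: "(nat \<Rightarrow> 3) \<Rightarrow> (nat \<Rightarrow> 'a::comm_ring_1 m3) set" where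
  "graded_tuples b = {X. \<forall>k i j. X k i j \<noteq> 0 \<longrightarrow> j - i = b k}"

abbreviation shift3 :: "'a m3 \<Rightarrow> 'a m3" where
  "shift3 \<equiv> relabel (\<lambda>i. i + 1)"

lemma numeral_type_3 [simp]: "(3::3) = 0" "(4::3) = 1" "(6::3) = 0"
  by simp_all

lemma graded_tuplesD: "X \<in> graded_tuples b \<Longrightarrow> X k i j \<noteq> 0 \<Longrightarrow> j - i = b k"
  by (simp add: graded_tuples_def)

lemma line_closed_graded_tuples: "line_closed (graded_tuples b)"
  unfolding line_closed_def
proof (intro ballI allI)
  fix X Y :: "nat \<Rightarrow> 'a m3" and t
  assume XY: "X \<in> graded_tuples b" "Y \<in> graded_tuples b"
  have "X k i j \<noteq> 0 \<or> Y k i j \<noteq> 0" if "X k i j + t * (Y k i j - X k i j) \<noteq> 0" for k i j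
    using that by auto
  then show "(\<lambda>k i j. X k i j + t * (Y k i j - X k i j)) \<in> graded_tuples b"
    using graded_tuplesD[OF XY(1)] graded_tuplesD[OF XY(2)] unfolding graded_tuples_def by blast
qed

lemma shift3_graded_tuples: "X \<in> graded_tuples b \<Longrightarrow> (\<lambda>k. shift3 (X k)) \<in> graded_tuples b"
  unfolding graded_tuples_def relabel_def by fastforce

lemma ev3_shift3: "ev3 m c (\<lambda>k. shift3 (X k)) i j = ev3 m c X (i + 1) (j + 1)"
proof -
  have "inj (\<lambda>i::3. i + 1)" by (simp add: inj_def)
  then have "bij (\<lambda>i::3. i + 1)" by (simp add: bij_def finite_UNIV_inj_surj)
  from ev3_relabel[OF this, of m c X] show ?thesis by (simp add: relabel_def)
qed

text \<open>The identity on indices serves as a weight in Z/3; total degree 1 leaves only the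
  positions (\<open>i\<close>, \<open>i + 1\<close>).\<close>

lemma ev3_graded_tuples:
  assumes "X \<in> graded_tuples b" "(\<Sum>k<m. b k) = 1" "j \<noteq> i + 1"
  shows "ev3 m c X i j = 0"
proof (rule ccontr)
  assume nz: "ev3 m c X i j \<noteq> 0"
  have "j - i = (\<Sum>k<m. b k)"
    by (rule ev3_graded[OF _ nz, where h = "\<lambda>x. x"]) (rule graded_tuplesD[OF assms(1)])
  with assms show False by (simp add: algebra_simps)
qed

lemma line_poly_ev3_upd: "line_poly (\<lambda>X. ev3 m c (X(k := X n)) i j)"
proof -
  have "(X(k := X n)) = (\<lambda>l. X (if l = k then n else l))" for X :: "nat \<Rightarrow> 'a m3"
    by auto
  then show ?thesis
    using line_poly_reindex[OF line_poly_ev3[of m c i j], where r = "\<lambda>l. if l = k then n else l"]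
    by simp
qed

lemma unit_tuple_graded: "(\<lambda>k. unit3 (r k) (s k)) \<in> graded_tuples (\<lambda>k. s k - r k)"
  by (auto simp: graded_tuples_def unit3_def)

lemma unit_tuple_degree:
  assumes "ev3 m c (\<lambda>k. unit3 (r k) (s k)) 0 1 \<noteq> 0"
  shows "(\<Sum>k<m. s k - r k) = 1"
proof -
  have "1 - 0 = (\<Sum>k<m. s k - r k)"
    by (rule ev3_graded[OF _ assms, where h = "\<lambda>x. x"]) (simp add: unit3_def split: if_splits)
  then show ?thesis by simp
qed

text \<open>If every slot of the forms \<open>X \<mapsto> ev3 m c X 0 1\<close> and \<open>X \<mapsto> ev3 m c X 1 2\<close> were proportional,
  one could walk slot by slot from the unit tuple, where the second form vanishes and the first
  does not, to a generic tuple and conclude that the second form vanishes there.\<close>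

lemma unit_tuple_nonproportional_slot:
  fixes c :: "(nat \<Rightarrow> nat) \<Rightarrow> 'a::alg_closed_field" and m :: nat
  defines "f \<equiv> \<lambda>i X. ev3 m c X i (i + 1)"
  assumes u: "ev3 m c (\<lambda>k. unit3 (r k) (s k)) 0 1 \<noteq> 0"
  shows "\<exists>k X Y. k < m \<and> X \<in> graded_tuples (\<lambda>k. s k - r k) \<and> (\<forall>i j. Y i j \<noteq> 0 \<longrightarrow> j - i = s k - r k)
    \<and> f 0 X * f 1 (X(k := Y)) \<noteq> f 0 (X(k := Y)) * f 1 X"
proof (rule ccontr)
  define G :: "(nat \<Rightarrow> 'a m3) set" where "G = graded_tuples (\<lambda>k. s k - r k)"
  define U :: "nat \<Rightarrow> 'a m3" where "U = (\<lambda>k. unit3 (r k) (s k))"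
  define mix where "mix n Z = (\<lambda>k. if k < n then Z k else U k)" for n and Z :: "nat \<Rightarrow> 'a m3"
  assume no: "\<nexists>k X Y. k < m \<and> X \<in> graded_tuples (\<lambda>k. s k - r k)
    \<and> (\<forall>i j. Y i j \<noteq> 0 \<longrightarrow> j - i = s k - r k) \<and> f 0 X * f 1 (X(k := Y)) \<noteq> f 0 (X(k := Y)) * f 1 X"
  have slotwise: "f 0 X * f 1 (X(k := Y)) = f 0 (X(k := Y)) * f 1 X"
    if "k < m" "X \<in> G" "\<And>i j. Y i j \<noteq> 0 \<Longrightarrow> j - i = s k - r k" for k X Y
  proof (rule ccontr)
    assume "f 0 X * f 1 (X(k := Y)) \<noteq> f 0 (X(k := Y)) * f 1 X"
    with that have "k < m \<and> X \<in> graded_tuples (\<lambda>k. s k - r k)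
      \<and> (\<forall>i j. Y i j \<noteq> 0 \<longrightarrow> j - i = s k - r k)
      \<and> f 0 X * f 1 (X(k := Y)) \<noteq> f 0 (X(k := Y)) * f 1 X"
      unfolding G_def by simp
    then have "\<exists>k X Y. k < m \<and> X \<in> graded_tuples (\<lambda>k. s k - r k)
      \<and> (\<forall>i j. Y i j \<noteq> 0 \<longrightarrow> j - i = s k - r k)
      \<and> f 0 X * f 1 (X(k := Y)) \<noteq> f 0 (X(k := Y)) * f 1 X"
      by (intro exI)
    with no show False ..
  qed
  have U: "U \<in> G" unfolding U_def G_def by (rule unit_tuple_graded)
  \<comment> \<open>Two shifts carry the nonzero entry from (0, 1) to (1, 2).\<close>
  define W where "W = (\<lambda>k. shift3 (shift3 (U k)))"
  have W: "W \<in> G" using U shift3_graded_tuples unfolding W_def G_def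
    by (intro shift3_graded_tuples)
  have "f 1 W = ev3 m c U 0 1"
    unfolding f_def W_def ev3_shift3 by simp
  then have "f 1 W \<noteq> 0" using u by (simp add: U_def)
  \<comment> \<open>The product runs over all intermediate tuples, so that one generic
    \<open>Z\<close> keeps \<open>f 0\<close> nonzero along the whole walk.\<close>
  moreover have "(\<Prod>n\<le>m. f 0 (mix n U)) \<noteq> 0"
  proof -
    have "mix n U = U" for n by (auto simp: mix_def)
    then show ?thesis using u by (simp add: f_def U_def)
  qed
  moreover have "line_poly (\<lambda>Z. \<Prod>n\<le>m. f 0 (mix n Z))"
    unfolding f_def mix_def by (intro line_poly_prod line_poly_mix line_poly_ev3)
  moreover have "line_poly (f 1)" unfolding f_def by (rule line_poly_ev3)
  moreover have "line_closed G" unfolding G_def by (rule line_closed_graded_tuples)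
  ultimately obtain Z where Z: "Z \<in> G" "(\<Prod>n\<le>m. f 0 (mix n Z)) \<noteq> 0" "f 1 Z \<noteq> 0"
    using U W line_poly_nonzero[of "\<lambda>Z. \<Prod>n\<le>m. f 0 (mix n Z)" "f 1" G U W] by blast
  have "f 1 (mix n Z) = 0" if "n \<le> m" for n
    using that
  proof (induction n)
    case 0
    have "ev3 m c U 1 2 = 0"
      unfolding U_def by (rule ev3_unit_tuple_offdiag[OF u]) simp
    then show ?case by (simp add: mix_def f_def)
  next
    case (Suc n)
    have mix: "mix n Z \<in> G"
      using Z(1) U unfolding G_def graded_tuples_def mix_def by auto
    have upd: "mix (Suc n) Z = (mix n Z)(n := Z n)"
      by (rule ext) (auto simp: mix_def)
    have "f 0 (mix n Z) * f 1 (mix (Suc n) Z) = f 0 (mix (Suc n) Z) * f 1 (mix n Z)"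
      unfolding upd using Z(1) Suc.prems
      by (intro slotwise mix) (auto simp: G_def graded_tuples_def)
    \<comment> \<open>Cancelling this factor passes the vanishing of \<open>f 1\<close> on to the
      next tuple.\<close>
    moreover have "f 0 (mix n Z) \<noteq> 0" using Z(2) Suc.prems by auto
    ultimately show ?case using Suc by simp
  qed
  moreover have "f 1 (mix m Z) = f 1 Z"
    unfolding f_def by (rule arg_cong[where f = "\<lambda>A. A _ _"], rule ev3_cong) (simp add: mix_def)
  ultimately show False using Z(3) by auto
qed

text \<open>The evaluation ignores slot \<open>m\<close>, which stores the second argument for slot \<open>k\<close>.\<close>

lemma graded_pair:
  fixes c :: "(nat \<Rightarrow> nat) \<Rightarrow> 'a::alg_closed_field"
  assumes u: "ev3 m c (\<lambda>k. unit3 (r k) (s k)) 0 1 \<noteq> 0"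
  obtains k Z where "k < m"
    "\<And>i j. j \<noteq> i + 1 \<Longrightarrow> ev3 m c Z i j = 0"
    "\<And>i j. j \<noteq> i + 1 \<Longrightarrow> ev3 m c (Z(k := Z m)) i j = 0"
    "\<And>i. ev3 m c Z i (i + 1) * ev3 m c (Z(k := Z m)) (i + 1) (i + 2)
       - ev3 m c (Z(k := Z m)) i (i + 1) * ev3 m c Z (i + 1) (i + 2) \<noteq> 0"
proof -
  obtain k X Y where kXY: "k < m" "X \<in> graded_tuples (\<lambda>k. s k - r k)"
      "\<And>i j. Y i j \<noteq> 0 \<Longrightarrow> j - i = s k - r k"
    and ne: "ev3 m c X 0 1 * ev3 m c (X(k := Y)) 1 2 \<noteq> ev3 m c (X(k := Y)) 0 1 * ev3 m c X 1 2"
    using unit_tuple_nonproportional_slot[OF u] by auto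
  \<comment> \<open>Slot \<open>m\<close> receives the degree of slot \<open>k\<close>, so that
    copying it into slot \<open>k\<close> preserves homogeneity.\<close>
  define b where "b = (\<lambda>l. if l = m then s k - r k else s l - r l)"
  define G :: "(nat \<Rightarrow> 'a m3) set" where "G = graded_tuples b"
  define \<Delta> where "\<Delta> i Z = ev3 m c Z i (i + 1) * ev3 m c (Z(k := Z m)) (i + 1) (i + 2)
       - ev3 m c (Z(k := Z m)) i (i + 1) * ev3 m c Z (i + 1) (i + 2)" for i Z
  define Z0 where "Z0 = X(m := Y)"
  have G: "line_closed G" unfolding G_def by (rule line_closed_graded_tuples)
  have Z0: "Z0 \<in> G"
    using kXY unfolding G_def Z0_def b_def graded_tuples_def by auto
  have "ev3 m c Z0 = ev3 m c X" "ev3 m c (Z0(k := Z0 m)) = ev3 m c (X(k := Y))"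
    unfolding Z0_def by (rule ev3_cong; simp)+
  then have \<Delta>0: "\<Delta> 0 Z0 \<noteq> 0" using ne by (simp add: \<Delta>_def)
  \<comment> \<open>Shifting the arguments turns each \<open>\<Delta>\<close> into the next one, so
    all three are nonzero somewhere on \<open>G\<close> and hence at a common point.\<close>
  have shift: "\<Delta> i (\<lambda>k. shift3 (Z k)) = \<Delta> (i + 1) Z" for i Z
  proof -
    have "(\<lambda>k. shift3 (Z k))(k := shift3 (Z m)) = (\<lambda>l. shift3 ((Z(k := Z m)) l))" by auto
    then show ?thesis unfolding \<Delta>_def
      by (simp only: ev3_shift3 add.assoc add.commute[of 2 1])
  qed
  define Z1 where "Z1 = (\<lambda>k. shift3 (Z0 k))"
  define Z2 where "Z2 = (\<lambda>k. shift3 (Z1 k))"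
  have Z12: "Z1 \<in> G" "Z2 \<in> G"
    using Z0 shift3_graded_tuples unfolding Z1_def Z2_def G_def by (intro shift3_graded_tuples; simp)+
  have \<Delta>12: "\<Delta> 2 Z1 \<noteq> 0" "\<Delta> 1 Z2 \<noteq> 0"
    using \<Delta>0 by (simp_all add: Z1_def Z2_def shift)
  have \<Delta>_poly: "line_poly (\<Delta> i)" for i
    unfolding \<Delta>_def by (intro line_poly_intros line_poly_ev3_upd)
  obtain Z3 where Z3: "Z3 \<in> G" "\<Delta> 0 Z3 \<noteq> 0" "\<Delta> 2 Z3 \<noteq> 0"
    using line_poly_nonzero[OF \<Delta>_poly \<Delta>_poly G Z0 Z12(1) \<Delta>0 \<Delta>12(1)] .
  have "line_poly (\<lambda>Z. \<Delta> 0 Z * \<Delta> 2 Z)" by (intro line_poly_mult \<Delta>_poly)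
  moreover have "\<Delta> 0 Z3 * \<Delta> 2 Z3 \<noteq> 0" using Z3 by simp
  ultimately obtain Z where Z: "Z \<in> G" "\<Delta> 0 Z * \<Delta> 2 Z \<noteq> 0" "\<Delta> 1 Z \<noteq> 0"
    using line_poly_nonzero[OF _ \<Delta>_poly G Z3(1) Z12(2) _ \<Delta>12(2), of "\<lambda>Z. \<Delta> 0 Z * \<Delta> 2 Z"] by metis
  have deg: "(\<Sum>k<m. b k) = 1"
    using unit_tuple_degree[OF u] by (simp add: b_def)
  have Z': "Z(k := Z m) \<in> G"
    using Z(1) kXY(1) unfolding G_def graded_tuples_def b_def by auto
  show thesis
  proof (rule that[OF kXY(1)])
    fix i j :: 3
    assume "j \<noteq> i + 1"
    then show "ev3 m c Z i j = 0" "ev3 m c (Z(k := Z m)) i j = 0"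
      using ev3_graded_tuples[OF _ deg] Z(1) Z' unfolding G_def by blast+
  next
    fix i :: 3
    have "\<Delta> i Z \<noteq> 0" using Z(2,3) by (cases i rule: exhaust_3) auto
    then show "ev3 m c Z i (i + 1) * ev3 m c (Z(k := Z m)) (i + 1) (i + 2)
       - ev3 m c (Z(k := Z m)) i (i + 1) * ev3 m c Z (i + 1) (i + 2) \<noteq> 0"
      by (simp add: \<Delta>_def)
  qed
qed

text \<open>Each of the three cyclic shifts of the unit tuple makes a different one of the three
  entries nonzero; a generic graded tuple makes all of them nonzero. Such a value is invertible and
  has \<open>q3\<close> equal to zero.\<close>

lemma graded_invertible:
  fixes c :: "(nat \<Rightarrow> nat) \<Rightarrow> 'a::alg_closed_field"
  assumes u: "ev3 m c (\<lambda>k. unit3 (r k) (s k)) 0 1 \<noteq> 0"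
  obtains X where "\<And>i j. j \<noteq> i + 1 \<Longrightarrow> ev3 m c X i j = 0" "\<And>i. ev3 m c X i (i + 1) \<noteq> 0"
proof -
  define G :: "(nat \<Rightarrow> 'a m3) set" where "G = graded_tuples (\<lambda>k. s k - r k)"
  define f where "f i X = ev3 m c X i (i + 1)" for i and X :: "nat \<Rightarrow> 'a m3"
  define U where "U = (\<lambda>k. unit3 (r k) (s k) :: 'a m3)"
  define U1 where "U1 = (\<lambda>k. shift3 (U k))"
  define U2 where "U2 = (\<lambda>k. shift3 (U1 k))"
  have G: "line_closed G" unfolding G_def by (rule line_closed_graded_tuples)
  have U: "U \<in> G" "U1 \<in> G" "U2 \<in> G"
    unfolding U_def U1_def U2_def G_def by (intro shift3_graded_tuples unit_tuple_graded)+
  have fU: "f 0 U \<noteq> 0" "f 2 U1 \<noteq> 0" "f 1 U2 \<noteq> 0"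
    using u unfolding f_def U2_def U1_def ev3_shift3 by (simp_all add: U_def)
  have f_poly: "line_poly (f i)" for i unfolding f_def by (rule line_poly_ev3)
  obtain V where V: "V \<in> G" "f 0 V \<noteq> 0" "f 2 V \<noteq> 0"
    using line_poly_nonzero[OF f_poly f_poly G U(1,2) fU(1,2)] .
  have "line_poly (\<lambda>Z. f 0 Z * f 2 Z)" by (intro line_poly_mult f_poly)
  moreover have "f 0 V * f 2 V \<noteq> 0" using V by simp
  ultimately obtain X where X: "X \<in> G" "f 0 X * f 2 X \<noteq> 0" "f 1 X \<noteq> 0"
    using line_poly_nonzero[OF _ f_poly G V(1) U(3) _ fU(3), of "\<lambda>Z. f 0 Z * f 2 Z"] by metis
  have deg: "(\<Sum>k<m. s k - r k) = 1" by (rule unit_tuple_degree[OF u])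
  show thesis
  proof (rule that)
    fix i j :: 3
    assume "j \<noteq> i + 1"
    then show "ev3 m c X i j = 0"
      using ev3_graded_tuples[OF _ deg] X(1) unfolding G_def by blast
  next
    fix i :: 3
    have "f i X \<noteq> 0" using X(2,3) by (cases i rule: exhaust_3) auto
    then show "ev3 m c X i (i + 1) \<noteq> 0" by (simp add: f_def)
  qed
qed

section \<open>Pencils of values\<close>

lemma det3_scale: "det3 (\<lambda>i j. t * A i j) = t ^ 3 * det3 A"
  by (simp add: det3_def algebra_simps power3_eq_cube)

lemma q3_scale: "q3 (\<lambda>i j. t * A i j) = t ^ 2 * q3 A"
  by (simp add: q3_def algebra_simps power2_eq_square)

text \<open>The coefficient of \<open>s ^ 2\<close> in the determinant of \<open>s A + B\<close>,
  obtained by replacing one row of \<open>A\<close> at a time.\<close>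

definition mixed_det3 :: "'a::comm_ring_1 m3 \<Rightarrow> 'a m3 \<Rightarrow> 'a" where
  "mixed_det3 A B = det3 (A(0 := B 0)) + det3 (A(1 := B 1)) + det3 (A(2 := B 2))"

lemma det3_pencil:
  "det3 (\<lambda>i j. s * A i j + B i j)
    = s ^ 3 * det3 A + s ^ 2 * mixed_det3 A B + s * mixed_det3 B A + det3 B"
  by (simp add: det3_def mixed_det3_def algebra_simps power2_eq_square power3_eq_cube)

lemma q3_pencil:
  "q3 (\<lambda>i j. s * A i j + B i j)
    = s ^ 2 * q3 A + s * (q3 (\<lambda>i j. A i j + B i j) - q3 A - q3 B) + q3 B"
  by (simp add: q3_def algebra_simps power2_eq_square)

text \<open>Discriminant of the cubic with coefficients \<open>a\<close>, \<open>b\<close>,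
  \<open>c\<close>, \<open>d\<close> from the leading one down.\<close>

definition cubic_disc :: "'a::comm_ring_1 \<Rightarrow> 'a \<Rightarrow> 'a \<Rightarrow> 'a \<Rightarrow> 'a" where
  "cubic_disc a b c d = b\<^sup>2 * c\<^sup>2 - 4 * a * c ^ 3 - 4 * b ^ 3 * d + 18 * a * b * c * d - 27 * a\<^sup>2 * d\<^sup>2"

definition pencil_disc :: "'a::comm_ring_1 m3 \<Rightarrow> 'a m3 \<Rightarrow> 'a" where
  "pencil_disc A B = cubic_disc (det3 A) (mixed_det3 A B) (mixed_det3 B A) (det3 B)"

text \<open>The arguments are the coefficients of a product of three linear forms; its discriminant
  is the squared product of their pairwise resultants.\<close>

lemma cubic_disc_linear_forms:
  "cubic_disc (a0 * a1 * a2) (b0 * a1 * a2 + a0 * b1 * a2 + a0 * a1 * b2)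
      (a0 * b1 * b2 + b0 * a1 * b2 + b0 * b1 * a2) (b0 * b1 * b2)
    = ((a0 * b1 - b0 * a1) * (a1 * b2 - b1 * a2) * (a2 * b0 - b2 * a0))\<^sup>2"
  unfolding cubic_disc_def by (simp add: algebra_simps power2_eq_square power3_eq_cube)

text \<open>The determinant of a graded pencil is the product of three linear forms, given by the
  entries (0, 1), (1, 2) and (2, 0).\<close>

lemma pencil_disc_graded:
  assumes A: "\<And>i j. j \<noteq> i + 1 \<Longrightarrow> A i j = 0" and B: "\<And>i j. j \<noteq> i + 1 \<Longrightarrow> B i j = 0"
  shows "pencil_disc A B = ((A 0 1 * B 1 2 - B 0 1 * A 1 2) * (A 1 2 * B 2 0 - B 1 2 * A 2 0)
    * (A 2 0 * B 0 1 - B 2 0 * A 0 1))\<^sup>2"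
proof -
  have [simp]: "A 0 0 = 0" "A 0 2 = 0" "A 1 0 = 0" "A 1 1 = 0" "A 2 1 = 0" "A 2 2 = 0"
    "B 0 0 = 0" "B 0 2 = 0" "B 1 0 = 0" "B 1 1 = 0" "B 2 1 = 0" "B 2 2 = 0"
    by (simp_all add: A B)
  have "det3 A = A 0 1 * A 1 2 * A 2 0" "det3 B = B 0 1 * B 1 2 * B 2 0"
    "mixed_det3 A B = B 0 1 * A 1 2 * A 2 0 + A 0 1 * B 1 2 * A 2 0 + A 0 1 * A 1 2 * B 2 0"
    "mixed_det3 B A = A 0 1 * B 1 2 * B 2 0 + B 0 1 * A 1 2 * B 2 0 + B 0 1 * B 1 2 * A 2 0"
    by (simp_all add: det3_def mixed_det3_def)
  then show ?thesis
    unfolding pencil_disc_def by (simp only: cubic_disc_linear_forms)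
qed

lemma line_poly_det3: "(\<And>i j. line_poly (\<lambda>X. F X i j)) \<Longrightarrow> line_poly (\<lambda>X. det3 (F X))"
  unfolding det3_def by (intro line_poly_intros)

lemma line_poly_q3: "(\<And>i j. line_poly (\<lambda>X. F X i j)) \<Longrightarrow> line_poly (\<lambda>X. q3 (F X))"
  unfolding q3_def by (intro line_poly_intros)

lemma line_poly_pencil_disc:
  assumes F: "\<And>i j. line_poly (\<lambda>X. F X i j)" and H: "\<And>i j. line_poly (\<lambda>X. H X i j)"
  shows "line_poly (\<lambda>X. pencil_disc (F X) (H X))"
proof -
  have "line_poly (\<lambda>X. mixed_det3 (F X) (H X))"
    if "\<And>i j. line_poly (\<lambda>X. F X i j)" "\<And>i j. line_poly (\<lambda>X. H X i j)" for F H
  proof -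
    have "line_poly (\<lambda>X. ((F X)(k := H X k)) i j)" for k i j
      using that by (cases "i = k") simp_all
    then show ?thesis
      unfolding mixed_det3_def by (intro line_poly_add line_poly_det3)
  qed
  from this[OF F H] this[OF H F] show ?thesis
    unfolding pencil_disc_def cubic_disc_def
    by (intro line_poly_intros line_poly_det3 F H)
qed

section \<open>Prescribed values of \<open>q3\<close> and \<open>det3\<close> on a pencil\<close>

lemma cubic_splits:
  fixes F :: "'a::alg_closed_field poly"
  assumes "degree F = 3"
  obtains r1 r2 r3 where "F = Polynomial.smult (lead_coeff F) ([:- r1, 1:] * [:- r2, 1:] * [:- r3, 1:])"
proof -
  have "F \<noteq> 0" using assms by auto
  then obtain M where M: "size M = degree F" "F = Polynomial.smult (lead_coeff F) (\<Prod>x\<in>#M. [:- x, 1:])"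
    using alg_closed_imp_factorization by blast
  from M(1) assms have "size M = Suc (Suc (Suc 0))" by simp
  then obtain r1 M1 where 1: "M = add_mset r1 M1" "size M1 = Suc (Suc 0)"
    by (metis size_eq_Suc_imp_eq_union size_add_mset add_left_cancel nat.inject)
  then obtain r2 M2 where 2: "M1 = add_mset r2 M2" "size M2 = Suc 0"
    by (metis size_eq_Suc_imp_eq_union size_add_mset nat.inject)
  then obtain r3 where 3: "M2 = {#r3#}"
    by (metis size_1_singleton_mset One_nat_def)
  show thesis
    by (rule that[of r1 r2 r3], subst M(2), unfold 1 2 3) (simp only: image_mset_add_mset
        image_mset_single prod_mset.add_mset image_mset_empty prod_mset_empty mult_1_right mult.assoc)
qed

text \<open>With \<open>x = t s\<close> and \<open>y = t\<close> the equations read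
  \<open>t^2 Q(s) = q\<close> and \<open>t^3 F(s) = d\<close>. For nonzero \<open>d\<close>,
  eliminating \<open>t\<close> asks for a root of \<open>d^2 Q^3 - q^3 F^2\<close> at which
  \<open>Q\<close> is nonzero. Unless the leading terms cancel, it exists because \<open>F\<close>
  has simple roots and \<open>Q\<close> has at most two roots.\<close>

lemma pencil_attains:
  fixes A B :: "'a::alg_closed_field m3"
  assumes disc: "pencil_disc A B \<noteq> 0" and detA: "det3 A \<noteq> 0" and qA: "q3 A \<noteq> 0" and q: "q \<noteq> 0"
  shows "\<exists>x y. q3 (\<lambda>i j. x * A i j + y * B i j) = q \<and> det3 (\<lambda>i j. x * A i j + y * B i j) = d"
proof -
  define F where "F = [:det3 B, mixed_det3 B A, mixed_det3 A B, det3 A:]"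
  define Q where "Q = [:q3 B, q3 (\<lambda>i j. A i j + B i j) - q3 A - q3 B, q3 A:]"
  have F: "poly F s = det3 (\<lambda>i j. s * A i j + B i j)" for s
    unfolding det3_pencil by (simp add: F_def algebra_simps power2_eq_square power3_eq_cube)
  have Q: "poly Q s = q3 (\<lambda>i j. s * A i j + B i j)" for s
    unfolding q3_pencil by (simp add: Q_def algebra_simps power2_eq_square)
  have degF: "degree F = 3" "lead_coeff F = det3 A" using detA by (simp_all add: F_def)
  have degQ: "degree Q = 2" "lead_coeff Q = q3 A" using qA by (simp_all add: Q_def)
  have "F \<noteq> 0" "Q \<noteq> 0" using degF degQ by auto
  have card_Q: "finite {x. poly Q x = 0}" "card {x. poly Q x = 0} \<le> 2"
    using poly_roots_finite[of Q] card_poly_roots_bound[of Q] degQ(1) \<open>Q \<noteq> 0\<close> by simp_all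
  obtain r1 r2 r3 where r: "F = Polynomial.smult (det3 A) ([:- r1, 1:] * [:- r2, 1:] * [:- r3, 1:])"
    using cubic_splits[OF degF(1)] degF(2) by metis
  have F_roots: "poly F x = det3 A * ((x - r1) * (x - r2) * (x - r3))" for x
    unfolding r poly_smult poly_mult by simp
  have coeffs: "det3 B = - det3 A * r1 * r2 * r3" "mixed_det3 B A = det3 A * (r1 * r2 + r1 * r3 + r2 * r3)"
    "mixed_det3 A B = - det3 A * (r1 + r2 + r3)"
    using r unfolding F_def by (simp_all add: algebra_simps)
  \<comment> \<open>The leading coefficient goes into the first linear factor; then
    \<open>cubic_disc_linear_forms\<close> shows that the roots are distinct.\<close>
  have "pencil_disc A B = cubic_disc (det3 A * 1 * 1)
      (- det3 A * r1 * 1 * 1 + det3 A * - r2 * 1 + det3 A * 1 * - r3)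
      (det3 A * - r2 * - r3 + - det3 A * r1 * 1 * - r3 + - det3 A * r1 * - r2 * 1)
      (- det3 A * r1 * - r2 * - r3)"
    unfolding pencil_disc_def coeffs by (simp add: algebra_simps)
  then have "pencil_disc A B = ((det3 A * - r2 - - det3 A * r1 * 1) * (1 * - r3 - - r2 * 1)
      * (1 * (- det3 A * r1) - - r3 * det3 A))\<^sup>2"
    unfolding cubic_disc_linear_forms .
  with disc have distinct: "r1 \<noteq> r2" "r1 \<noteq> r3" "r2 \<noteq> r3" by auto
  have witness: ?thesis
    if "t ^ 2 * poly Q s = q" "t ^ 3 * poly F s = d" for s t
  proof (intro exI conjI)
    have eq: "(\<lambda>i j. t * s * A i j + t * B i j) = (\<lambda>i j. t * (s * A i j + B i j))"
      by (simp add: algebra_simps)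
    show "q3 (\<lambda>i j. t * s * A i j + t * B i j) = q" "det3 (\<lambda>i j. t * s * A i j + t * B i j) = d"
      unfolding eq q3_scale det3_scale using that by (simp_all add: F Q)
  qed
  show ?thesis
  proof (cases "d = 0")
    case True
    \<comment> \<open>Three distinct roots of \<open>F\<close> cannot all be among the at most two
      roots of \<open>Q\<close>.\<close>
    have "\<exists>s\<in>{r1, r2, r3}. poly Q s \<noteq> 0"
    proof (rule ccontr)
      assume "\<not> (\<exists>s\<in>{r1, r2, r3}. poly Q s \<noteq> 0)"
      then have "{r1, r2, r3} \<subseteq> {x. poly Q x = 0}" by auto
      from card_mono[OF card_Q(1) this] card_Q(2) distinct show False by simp
    qed
    then obtain s where s: "s \<in> {r1, r2, r3}" "poly Q s \<noteq> 0" by blast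
    obtain t where "t ^ 2 = q / poly Q s" using nth_root_exists[of 2 "q / poly Q s"] by auto
    moreover have "poly F s = 0" using s(1) by (auto simp: F_roots)
    ultimately show ?thesis using s True by (intro witness[of t s]) simp_all
  next
    case False
    define S where "S = Polynomial.smult (d ^ 2) (Q ^ 3) - Polynomial.smult (q ^ 3) (F ^ 2)"
    show ?thesis
    proof (cases "d ^ 2 * q3 A ^ 3 = q ^ 3 * det3 A ^ 2")
      case True
      \<comment> \<open>If the terms of degree 6 cancel, the solution is at infinity on the pencil:
        a multiple of \<open>A\<close> itself.\<close>
      define t where "t = (d / q) * (q3 A / det3 A)"
      have "t ^ 2 * q3 A = (d ^ 2 * q3 A ^ 3) / (q ^ 2 * det3 A ^ 2)"
        "t ^ 3 * det3 A = d * (d ^ 2 * q3 A ^ 3) / (q ^ 3 * det3 A ^ 2)"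
        using q detA by (simp_all add: t_def field_simps power2_eq_square power3_eq_cube)
      then have "t ^ 2 * q3 A = q" "t ^ 3 * det3 A = d"
        unfolding True using q detA by (simp_all add: field_simps power2_eq_square power3_eq_cube)
      then show ?thesis
        by (intro exI[of _ t] exI[of _ 0]) (simp add: q3_scale det3_scale)
    next
      case lead: False
      have degs: "degree (Q ^ 3) = 6" "degree (F ^ 2) = 6"
        using degF degQ \<open>F \<noteq> 0\<close> \<open>Q \<noteq> 0\<close> by (simp_all add: degree_power_eq)
      have "Polynomial.coeff (Q ^ 3) 6 = q3 A ^ 3" "Polynomial.coeff (F ^ 2) 6 = det3 A ^ 2"
        using degs degF degQ lead_coeff_power[of Q 3] lead_coeff_power[of F 2] by metis+
      then have "Polynomial.coeff S 6 \<noteq> 0" using lead by (simp add: S_def)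
      then have "degree S \<ge> 6" "S \<noteq> 0" by (auto intro: le_degree)
      then obtain M where M: "size M = degree S" "S = Polynomial.smult (lead_coeff S) (\<Prod>x\<in>#M. [:- x, 1:])"
        using alg_closed_imp_factorization by blast
      have S_root: "poly S x = 0" if "x \<in># M" for x
        using that by (subst M(2)) (auto simp: poly_prod_mset prod_mset_zero_iff)
      have "\<exists>s. poly S s = 0 \<and> poly Q s \<noteq> 0"
      proof (rule ccontr)
        assume none: "\<nexists>s. poly S s = 0 \<and> poly Q s \<noteq> 0"
        \<comment> \<open>At a root of \<open>S\<close> of multiplicity three that is also a root of
          \<open>Q\<close>, the cube of the linear factor would divide \<open>F ^ 2\<close>,
          although \<open>F\<close> has only simple roots.\<close>
        have count: "count M x \<le> 2" if x: "x \<in># M" for x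
        proof (rule ccontr)
          assume "\<not> count M x \<le> 2"
          then have "3 \<le> count M x" by simp
          then have "replicate_mset 3 x \<subseteq># M" by (rule count_le_replicate_mset_subset_eq[THEN iffD1])
          then obtain N where "M = replicate_mset 3 x + N" by (metis subset_mset.add_diff_inverse)
          then have "S = [:- x, 1:] ^ 3 * Polynomial.smult (lead_coeff S) (\<Prod>x\<in>#N. [:- x, 1:])"
            using M(2) by simp
          then have dvd_S: "[:- x, 1:] ^ 3 dvd S" by (rule dvdI)
          have Qx: "poly Q x = 0" using none S_root[OF x] by blast
          then have "[:- x, 1:] dvd Q" by (simp add: poly_eq_0_iff_dvd)
          then have "[:- x, 1:] ^ 3 dvd Polynomial.smult (d ^ 2) (Q ^ 3)"
            by (intro dvd_smult dvd_power_same)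
          then have "[:- x, 1:] ^ 3 dvd Polynomial.smult (d ^ 2) (Q ^ 3) - S"
            using dvd_S by (rule dvd_diff)
          then have "[:- x, 1:] ^ 3 dvd Polynomial.smult (q ^ 3) (F ^ 2)" by (simp add: S_def)
          then have dvd_F: "[:- x, 1:] ^ 3 dvd F ^ 2" using q by (simp add: dvd_smult_iff)
          have "poly F x = 0"
            using S_root[OF x] Qx q by (simp add: S_def)
          then have "x \<in> {r1, r2, r3}" using detA by (auto simp: F_roots)
          then obtain H where H: "F = [:- x, 1:] * H" "poly H x \<noteq> 0"
          proof (elim insertE emptyE)
            assume "x = r1"
            show thesis
            proof (rule that[of "Polynomial.smult (det3 A) ([:- r2, 1:] * [:- r3, 1:])"])
              show "F = [:- x, 1:] * Polynomial.smult (det3 A) ([:- r2, 1:] * [:- r3, 1:])"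
                unfolding r \<open>x = r1\<close> by (simp only: mult_smult_right mult_ac)
              show "poly (Polynomial.smult (det3 A) ([:- r2, 1:] * [:- r3, 1:])) x \<noteq> 0"
                unfolding poly_smult poly_mult using \<open>x = r1\<close> distinct detA by simp
            qed
          next
            assume "x = r2"
            show thesis
            proof (rule that[of "Polynomial.smult (det3 A) ([:- r1, 1:] * [:- r3, 1:])"])
              show "F = [:- x, 1:] * Polynomial.smult (det3 A) ([:- r1, 1:] * [:- r3, 1:])"
                unfolding r \<open>x = r2\<close> by (simp only: mult_smult_right mult_ac)
              show "poly (Polynomial.smult (det3 A) ([:- r1, 1:] * [:- r3, 1:])) x \<noteq> 0"
                unfolding poly_smult poly_mult using \<open>x = r2\<close> distinct detA by simp
            qed
          next
            assume "x = r3"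
            show thesis
            proof (rule that[of "Polynomial.smult (det3 A) ([:- r1, 1:] * [:- r2, 1:])"])
              show "F = [:- x, 1:] * Polynomial.smult (det3 A) ([:- r1, 1:] * [:- r2, 1:])"
                unfolding r \<open>x = r3\<close> by (simp only: mult_smult_right mult_ac)
              show "poly (Polynomial.smult (det3 A) ([:- r1, 1:] * [:- r2, 1:])) x \<noteq> 0"
                unfolding poly_smult poly_mult using \<open>x = r3\<close> distinct detA by simp
            qed
          qed
          have "[:- x, 1:] ^ 2 * [:- x, 1:] dvd [:- x, 1:] ^ 2 * H ^ 2"
            using dvd_F unfolding H(1) by (simp only: power3_eq_cube power2_eq_square mult_ac)
          then have "[:- x, 1:] ^ 2 = 0 \<or> [:- x, 1:] dvd H ^ 2"
            by (simp only: dvd_mult_cancel_left)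
          moreover have "[:- x, 1:] ^ 2 \<noteq> (0 :: 'a poly)" by simp
          ultimately have "[:- x, 1:] dvd H ^ 2" by blast
          then have "poly (H ^ 2) x = 0" by (rule poly_eq_0_iff_dvd[THEN iffD2])
          with H(2) show False by simp
        qed
        \<comment> \<open>At most two roots of multiplicity at most two account for degree at most
          4, against degree at least 6.\<close>
        have "set_mset M \<subseteq> {x. poly Q x = 0}" using none S_root by blast
        then have "card (set_mset M) \<le> 2" using card_Q card_mono le_trans by blast
        moreover have "size M \<le> 2 * card (set_mset M)"
          unfolding size_multiset_overloaded_eq using sum_bounded_above[of "set_mset M" "count M" 2] count
          by (simp add: mult.commute)
        ultimately show False using M(1) \<open>degree S \<ge> 6\<close> by simp
      qed
      then obtain s where s: "poly S s = 0" "poly Q s \<noteq> 0" by blast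
      then have eq: "d ^ 2 * poly Q s ^ 3 = q ^ 3 * poly F s ^ 2" by (simp add: S_def)
      with s(2) False have Fs: "poly F s \<noteq> 0" by auto
      \<comment> \<open>The quotient of the two target equations determines \<open>t\<close>; by
        \<open>eq\<close> both then hold.\<close>
      define t where "t = (d / q) * (poly Q s / poly F s)"
      have "t ^ 2 * poly Q s = (d ^ 2 * poly Q s ^ 3) / (q ^ 2 * poly F s ^ 2)"
        "t ^ 3 * poly F s = d * (d ^ 2 * poly Q s ^ 3) / (q ^ 3 * poly F s ^ 2)"
        using q Fs by (simp_all add: t_def field_simps power2_eq_square power3_eq_cube)
      then have "t ^ 2 * poly Q s = q" "t ^ 3 * poly F s = d"
        unfolding eq using q Fs by (simp_all add: field_simps power2_eq_square power3_eq_cube)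
      then show ?thesis by (rule witness)
    qed
  qed
qed

lemma ev3_scale:
  assumes "m \<ge> 1"
  shows "ev3 m c (X(0 := \<lambda>i j. t * X 0 i j)) = (\<lambda>i j. t * ev3 m c X i j)"
proof (intro ext)
  fix i j
  show "ev3 m c (X(0 := \<lambda>i j. t * X 0 i j)) i j = t * ev3 m c X i j"
    using ev3_linear[of 0 m c X t "X 0" 0 "X 0" i j] assms by simp
qed

lemma graded_q3_det3:
  assumes "\<And>i j. j \<noteq> i + 1 \<Longrightarrow> A i j = 0"
  shows "q3 A = 0" "det3 A = A 0 1 * A 1 2 * A 2 0"
  by (simp_all add: assms q3_def det3_def)

text \<open>For \<open>q = 0\<close> an invertible graded value is rescaled by a cube root.
  Otherwise the three nonvanishing conditions of \<open>pencil_attains\<close> hold generically: the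
  discriminant is nonzero at the graded pair, the determinant at \<open>V\<close>, and
  \<open>q3\<close> at \<open>X0\<close>.\<close>

lemma ev3_q3_det3_surj:
  fixes c :: "(nat \<Rightarrow> nat) \<Rightarrow> 'a::alg_closed_field"
  assumes m: "m \<ge> 1"
    and u: "ev3 m c (\<lambda>k. unit3 (r k) (s k)) 0 1 \<noteq> 0"
    and q3: "q3 (ev3 m c X0) \<noteq> 0"
  shows "\<exists>X. q3 (ev3 m c X) = q \<and> det3 (ev3 m c X) = d"
proof -
  obtain V where V: "\<And>i j. j \<noteq> i + 1 \<Longrightarrow> ev3 m c V i j = 0" "\<And>i. ev3 m c V i (i + 1) \<noteq> 0"
    using graded_invertible[OF u] by metis
  have V_q: "q3 (ev3 m c V) = 0" and V_det: "det3 (ev3 m c V) \<noteq> 0"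
    using graded_q3_det3[OF V(1)] V(2)[of 0] V(2)[of 1] V(2)[of 2] by simp_all
  show ?thesis
  proof (cases "q = 0")
    case True
    obtain t where "t ^ 3 = d / det3 (ev3 m c V)"
      using nth_root_exists[of 3 "d / det3 (ev3 m c V)"] by auto
    then show ?thesis
      using True V_q V_det
      by (intro exI[of _ "V(0 := \<lambda>i j. t * V 0 i j)"])
        (simp add: ev3_scale[OF m] q3_scale det3_scale)
  next
    case False
    obtain k Z where k: "k < m"
      and Z: "\<And>i j. j \<noteq> i + 1 \<Longrightarrow> ev3 m c Z i j = 0"
      and Z': "\<And>i j. j \<noteq> i + 1 \<Longrightarrow> ev3 m c (Z(k := Z m)) i j = 0"
      and \<Delta>: "\<And>i. ev3 m c Z i (i + 1) * ev3 m c (Z(k := Z m)) (i + 1) (i + 2)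
       - ev3 m c (Z(k := Z m)) i (i + 1) * ev3 m c Z (i + 1) (i + 2) \<noteq> 0"
      using graded_pair[OF u] by blast
    define D where "D Z = pencil_disc (ev3 m c Z) (ev3 m c (Z(k := Z m)))" for Z
    define T where "T Z = det3 (ev3 m c Z)" for Z
    define R where "R Z = q3 (ev3 m c Z)" for Z
    have "D Z \<noteq> 0"
      unfolding D_def using \<Delta>[of 0] \<Delta>[of 1] \<Delta>[of 2] by (simp add: pencil_disc_graded[OF Z Z'])
    moreover have "line_poly D" "line_poly T" "line_poly R"
      unfolding D_def T_def R_def
      by (intro line_poly_pencil_disc line_poly_det3 line_poly_q3 line_poly_ev3 line_poly_ev3_upd)+
    moreover have "T V \<noteq> 0" "R X0 \<noteq> 0" using V_det q3 by (simp_all add: T_def R_def)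
    ultimately obtain Y where "D Y \<noteq> 0" "T Y \<noteq> 0"
      using line_poly_nonzero[of D T UNIV Z V] by auto
    then have "D Y * T Y \<noteq> 0" by simp
    moreover have "line_poly (\<lambda>Z. D Z * T Z)"
      using \<open>line_poly D\<close> \<open>line_poly T\<close> by (rule line_poly_mult)
    ultimately obtain W where W: "D W * T W \<noteq> 0" "R W \<noteq> 0"
      using line_poly_nonzero[of "\<lambda>Z. D Z * T Z" R UNIV Y X0] \<open>line_poly R\<close> \<open>R X0 \<noteq> 0\<close> by auto
    obtain x y where
      "q3 (\<lambda>i j. x * ev3 m c W i j + y * ev3 m c (W(k := W m)) i j) = q"
      "det3 (\<lambda>i j. x * ev3 m c W i j + y * ev3 m c (W(k := W m)) i j) = d"
      using pencil_attains[OF _ _ _ False, of "ev3 m c W" "ev3 m c (W(k := W m))" d] W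
      unfolding D_def T_def R_def by auto
    \<comment> \<open>Linearity in slot \<open>k\<close> makes every member of the pencil a
      value.\<close>
    moreover have "ev3 m c (W(k := \<lambda>i j. x * W k i j + y * W m i j))
      = (\<lambda>i j. x * ev3 m c W i j + y * ev3 m c (W(k := W m)) i j)"
      using ev3_linear[OF k, of c W x "W k" y "W m"] by (intro ext) simp
    ultimately show ?thesis
      by (intro exI[of _ "W(k := \<lambda>i j. x * W k i j + y * W m i j)"]) simp
  qed
qed

section \<open>Similarity of 3x3 matrices\<close>

text \<open>With indices in Z/3 the cofactor signs disappear.\<close>

definition adj3 :: "'a::comm_ring_1 m3 \<Rightarrow> 'a m3" where
  "adj3 A = (\<lambda>i j. A (j + 1) (i + 1) * A (j + 2) (i + 2) - A (j + 1) (i + 2) * A (j + 2) (i + 1))"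

lemma m3_eqI:
  assumes "A 0 0 = B 0 0" "A 0 1 = B 0 1" "A 0 2 = B 0 2" "A 1 0 = B 1 0" "A 1 1 = B 1 1"
    "A 1 2 = B 1 2" "A 2 0 = B 2 0" "A 2 1 = B 2 1" "A 2 2 = (B 2 2 :: 'a)"
  shows "A = (B :: 'a m3)"
proof (intro ext)
  fix i j
  show "A i j = B i j"
    by (cases i rule: exhaust_3; cases j rule: exhaust_3) (simp_all add: assms)
qed

lemma mult3_adj3:
  "mult3 A (adj3 A) = (\<lambda>i j. det3 A * one3 i j)" "mult3 (adj3 A) A = (\<lambda>i j. det3 A * one3 i j)"
  by (rule m3_eqI; simp add: mult3_def adj3_def det3_def one3_def sum_3 algebra_simps)+

text \<open>Multiplying by \<open>A\<close> gives Cayley-Hamilton; when the trace, \<open>q3\<close>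
  and the square of \<open>A\<close> vanish, all 2x2 minors are zero.\<close>

lemma adj3_eq: "adj3 A = (\<lambda>i j. mult3 A A i j - tr3 A * A i j + q3 A * one3 i j)"
  by (rule m3_eqI; simp add: mult3_def adj3_def tr3_def q3_def one3_def sum_3 algebra_simps)

lemma inverse3:
  fixes S :: "'a::field m3"
  assumes "det3 S \<noteq> 0"
  obtains T where "mult3 S T = one3" "mult3 T S = one3"
proof
  define T where "T = (\<lambda>i j. adj3 S i j / det3 S)"
  have "mult3 S T i j = mult3 S (adj3 S) i j / det3 S" "mult3 T S i j = mult3 (adj3 S) S i j / det3 S" for i j
    by (simp_all add: mult3_def T_def sum_3 add_divide_distrib)
  then show "mult3 S T = one3" "mult3 T S = one3"
    using assms by (simp_all add: mult3_adj3 fun_eq_iff)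
qed

text \<open>The image is closed under conjugation, so one representative per similarity class
  suffices. In the form \<open>A S = S B\<close> it is enough to exhibit the columns of
  \<open>S\<close> as a basis.\<close>

lemma ev3_range_similar:
  fixes c :: "(nat \<Rightarrow> nat) \<Rightarrow> 'a::field"
  assumes S: "mult3 A S = mult3 S B" "det3 S \<noteq> 0"
  shows "A \<in> range (ev3 m c) \<longleftrightarrow> B \<in> range (ev3 m c)"
proof -
  obtain T where T: "mult3 S T = one3" "mult3 T S = one3" using inverse3[OF S(2)] .
  have "conj3 S T B = A"
    by (simp only: conj3_def S(1)[symmetric] mult3_assoc T mult3_one)
  moreover have "conj3 T S A = B"
    by (simp only: conj3_def mult3_assoc S(1)) (simp only: mult3_assoc[symmetric] T mult3_one)
  moreover have "conj3 S T (ev3 m c X) \<in> range (ev3 m c)" for X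
    by (rule range_eqI) (rule ev3_conj[OF T, symmetric])
  moreover have "conj3 T S (ev3 m c X) \<in> range (ev3 m c)" for X
    by (rule range_eqI) (rule ev3_conj[OF T(2,1), symmetric])
  ultimately show ?thesis by (auto simp: image_iff)
qed

section \<open>Transfer to \<open>mat\<close>\<close>

definition to_mat3 :: "'a m3 \<Rightarrow> 'a mat" where
  "to_mat3 A = mat 3 3 (\<lambda>(i, j). A (of_nat i) (of_nat j))"

lemma to_mat3_carrier [simp]: "to_mat3 A \<in> carrier_mat 3 3" "dim_row (to_mat3 A) = 3" "dim_col (to_mat3 A) = 3"
  by (simp_all add: to_mat3_def)

lemma less_3_cases: "i < 3 \<longleftrightarrow> i = 0 \<or> i = 1 \<or> i = (2::nat)"
  by auto

lemma det_carrier_2: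
  assumes "A \<in> carrier_mat 2 2"
  shows "det A = A $$ (0, 0) * A $$ (1, 1) - A $$ (0, 1) * A $$ (1, 0)"
proof -
  have "mat_delete A i 0 \<in> carrier_mat 1 1" for i using assms by (auto simp: mat_delete_def)
  then have "det (mat_delete A i 0) = mat_delete A i 0 $$ (0, 0)" for i by (rule det_single)
  then show ?thesis
    using laplace_expansion_column[OF assms, of 0] assms
    by (simp add: numeral_2_eq_2 cofactor_def mat_delete_def algebra_simps)
qed

lemma det_to_mat3: "det (to_mat3 A) = det3 A"
proof -
  have "mat_delete (to_mat3 A) i 0 \<in> carrier_mat 2 2" for i by (auto simp: mat_delete_def)
  note 2 = det_carrier_2[OF this]
  have "det (to_mat3 A) = (\<Sum>i<3. to_mat3 A $$ (i, 0) * cofactor (to_mat3 A) i 0)"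
    by (rule laplace_expansion_column) simp_all
  also have "\<dots> = det3 A"
    by (simp add: numeral_3_eq_3 cofactor_def 2)
      (simp add: mat_delete_def to_mat3_def det3_def algebra_simps numeral_2_eq_2)
  finally show ?thesis .
qed

lemma char_poly_to_mat3: "char_poly (to_mat3 A) = [:- det3 A, q3 A, - tr3 A, 1:]"
proof -
  \<comment> \<open>The characteristic matrix is itself a 3x3 matrix, over the polynomial ring,
    where \<open>det_to_mat3\<close> applies.\<close>
  have "char_poly_matrix (to_mat3 A) = to_mat3 (\<lambda>i j. if i = j then [:- A i j, 1:] else [:- A i j:])"
    by (rule eq_matI) (auto simp: char_poly_matrix_def to_mat3_def less_3_cases)
  then show ?thesis
    unfolding char_poly_def
    by (simp add: det_to_mat3) (simp add: det3_def q3_def tr3_def algebra_simps)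
qed

text \<open>Comparing coefficients reduces the spectrum of a traceless matrix to the pair of
  \<open>q3\<close> and \<open>det3\<close>.\<close>

lemma has_eigenvalues3_to_mat3:
  "has_eigenvalues3 (to_mat3 A) l1 l2 l3
    \<longleftrightarrow> tr3 A = l1 + l2 + l3 \<and> q3 A = l1 * l2 + l1 * l3 + l2 * l3 \<and> det3 A = l1 * l2 * l3"
proof -
  have "[:- l1, 1:] * [:- l2, 1:] * [:- l3, 1:]
    = [:- (l1 * l2 * l3), l1 * l2 + l1 * l3 + l2 * l3, - (l1 + l2 + l3), 1:]"
    by (simp add: algebra_simps)
  then show ?thesis
    unfolding has_eigenvalues3_def char_poly_to_mat3
    by (simp only: pCons_eq_iff neg_equal_iff_equal simp_thms) blast
qed

lemma to_mat3_surj: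
  assumes "M \<in> carrier_mat 3 3"
  obtains A where "M = to_mat3 A"
proof
  define ix :: "3 \<Rightarrow> nat" where "ix i = (if i = 0 then 0 else if i = 1 then 1 else 2)" for i
  show "M = to_mat3 (\<lambda>i j. M $$ (ix i, ix j))"
    using assms by (intro eq_matI) (auto simp: to_mat3_def ix_def less_3_cases)
qed

lemma to_mat3_mult: "to_mat3 A * to_mat3 B = to_mat3 (mult3 A B)"
  by (rule eq_matI) (auto simp: to_mat3_def mult3_def sum_3 scalar_prod_def numeral_3_eq_3)

lemma to_mat3_one: "to_mat3 one3 = 1\<^sub>m 3"
  by (rule eq_matI) (auto simp: to_mat3_def one3_def less_3_cases)

lemma ml_image_eq: "ml_image 3 m c = to_mat3 ` range (ev3 m c)"
proof -
  have eval: "ml_eval 3 m c Y = to_mat3 (ev3 m c X)" if Y: "\<And>k. k < m \<Longrightarrow> Y k = to_mat3 (X k)" for X Y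
  proof -
    have foldr: "foldr (\<lambda>k M. Y (\<sigma> k) * M) ks (1\<^sub>m 3) = to_mat3 (word3 X (map \<sigma> ks))"
      if "\<sigma> ` set ks \<subseteq> {0..<m}" for \<sigma> ks
      using that by (induction ks) (simp_all add: to_mat3_one Y to_mat3_mult)
    have "foldr (\<lambda>k M. Y (\<sigma> k) * M) [0..<m] (1\<^sub>m 3) = to_mat3 (word3 X (map \<sigma> [0..<m]))"
      if "\<sigma> permutes {0..<m}" for \<sigma>
      by (rule foldr) (use that permutes_image in fastforce)
    then show ?thesis
      unfolding ml_eval_def to_mat3_def ev3_def by (intro eq_matI) auto
  qed
  show ?thesis
  proof (intro equalityI subsetI)
    fix M assume "M \<in> ml_image 3 m c"
    then obtain Y where Y: "M = ml_eval 3 m c Y" "\<And>k. k < m \<Longrightarrow> Y k \<in> carrier_mat 3 3"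
      unfolding ml_image_def by auto
    have "\<exists>A. k < m \<longrightarrow> Y k = to_mat3 A" for k
      using to_mat3_surj[of "Y k"] Y(2)[of k] by metis
    then obtain X where "\<And>k. k < m \<Longrightarrow> Y k = to_mat3 (X k)" by metis
    from eval[of Y X, OF this] Y(1) show "M \<in> to_mat3 ` range (ev3 m c)" by simp
  next
    fix M assume "M \<in> to_mat3 ` range (ev3 m c)"
    then obtain X where X: "M = to_mat3 (ev3 m c X)" by blast
    from eval[of "\<lambda>k. to_mat3 (X k)" X]
    have "M = ml_eval 3 m c (\<lambda>k. to_mat3 (X k))" unfolding X by simp
    moreover have "\<forall>k<m. to_mat3 (X k) \<in> carrier_mat 3 3" by simp
    ultimately show "M \<in> ml_image 3 m c" unfolding ml_image_def by (intro CollectI exI conjI)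
  qed
qed

lemma mat_trace_to_mat3: "mat_trace (to_mat3 A) = tr3 A"
  by (simp add: mat_trace_def tr3_def to_mat3_def numeral_3_eq_3)

section \<open>Eigenvectors and normal forms\<close>

lemma kernel3:
  fixes S :: "'a::field m3"
  assumes "det3 S = 0"
  obtains v where "v \<noteq> (\<lambda>i. 0)" "\<And>i. (\<Sum>j\<in>UNIV. S i j * v j) = 0"
proof -
  have "det (to_mat3 S) = 0" using assms by (simp add: det_to_mat3)
  then obtain w where w: "w \<in> carrier_vec 3" "w \<noteq> 0\<^sub>v 3" "to_mat3 S *\<^sub>v w = 0\<^sub>v 3"
    using det_0_iff_vec_prod_zero_field[OF to_mat3_carrier(1)[of S]] by blast
  define v :: "3 \<Rightarrow> 'a" where "v i = (if i = 0 then w $ 0 else if i = 1 then w $ 1 else w $ 2)" for i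
  have w0: "w $ 0 = 0 \<and> w $ 1 = 0 \<and> w $ 2 = 0 \<Longrightarrow> w = 0\<^sub>v 3"
    using w(1) by (intro eq_vecI) (auto simp: less_3_cases)
  have "v \<noteq> (\<lambda>i. 0)"
  proof
    assume "v = (\<lambda>i. 0)"
    then have "v 0 = 0" "v 1 = 0" "v 2 = 0" by simp_all
    then show False using w0 w(2) by (simp add: v_def)
  qed
  moreover have "(\<Sum>j\<in>UNIV. S i j * v j) = 0" for i
  proof -
    have "(to_mat3 S *\<^sub>v w) $ k = 0" if "k < 3" for k using w(3) that by simp
    then have eq: "S (of_nat k) 0 * w $ 0 + S (of_nat k) 1 * w $ 1 + S (of_nat k) 2 * w $ 2 = 0" if "k < 3" for k
      using that w(1) by (simp add: to_mat3_def scalar_prod_def numeral_3_eq_3 numeral_2_eq_2)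
    show ?thesis
      using eq[of 0] eq[of 1] eq[of 2] by (cases i rule: exhaust_3) (simp_all add: sum_3 v_def)
  qed
  ultimately show thesis by (rule that)
qed

definition cols3 :: "(3 \<Rightarrow> 'a) \<Rightarrow> (3 \<Rightarrow> 'a) \<Rightarrow> (3 \<Rightarrow> 'a) \<Rightarrow> 'a m3" where
  "cols3 x y z = (\<lambda>i j. if j = 0 then x i else if j = 1 then y i else z i)"

lemma det3_cols3_nonzero:
  fixes x y z :: "3 \<Rightarrow> 'a::field"
  assumes "\<And>a b c. (\<And>i. a * x i + b * y i + c * z i = 0) \<Longrightarrow> a = 0 \<and> b = 0 \<and> c = 0"
  shows "det3 (cols3 x y z) \<noteq> 0"
proof
  assume "det3 (cols3 x y z) = 0"
  then obtain v where v: "v \<noteq> (\<lambda>i. 0)" "\<And>i. (\<Sum>j\<in>UNIV. cols3 x y z i j * v j) = 0"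
    using kernel3 by blast
  then have "v 0 * x i + v 1 * y i + v 2 * z i = 0" for i
    using v(2)[of i] by (simp add: cols3_def sum_3 mult.commute)
  from assms[of "v 0" "v 1" "v 2", OF this] have "v 0 = 0" "v 1 = 0" "v 2 = 0" by simp_all
  then have "v i = 0" for i by (cases i rule: exhaust_3) simp_all
  with v(1) show False by auto
qed

definition app3 :: "'a::comm_ring_1 m3 \<Rightarrow> (3 \<Rightarrow> 'a) \<Rightarrow> 3 \<Rightarrow> 'a" where
  "app3 A v = (\<lambda>i. \<Sum>j\<in>UNIV. A i j * v j)"

lemma mult3_cols3: "mult3 A (cols3 x y z) = cols3 (app3 A x) (app3 A y) (app3 A z)"
  by (rule m3_eqI) (simp_all add: mult3_def cols3_def app3_def)

lemma app3_comb:
  assumes "\<And>i. a * x i + b * y i + c * z i = 0"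
  shows "a * app3 A x i + b * app3 A y i + c * app3 A z i = 0"
proof -
  have "a * app3 A x i + b * app3 A y i + c * app3 A z i
    = (\<Sum>j\<in>UNIV. A i j * (a * x j + b * y j + c * z j))"
    by (simp add: app3_def sum_3 algebra_simps)
  then show ?thesis by (simp add: assms)
qed

lemma vandermonde3:
  fixes a b c :: "'a::field"
  assumes "x + y + z = 0" "a * x + b * y + c * z = 0" "a\<^sup>2 * x + b\<^sup>2 * y + c\<^sup>2 * z = 0"
    and "a \<noteq> b" "a \<noteq> c"
  shows "x = 0"
proof -
  \<comment> \<open>The equations are combined with the coefficients of
    \<open>(t - b) (t - c)\<close>, which vanishes at \<open>b\<close> and \<open>c\<close>.\<close>
  have "(a - b) * (a - c) * x = (a\<^sup>2 * x + b\<^sup>2 * y + c\<^sup>2 * z)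
    - (b + c) * (a * x + b * y + c * z) + b * c * (x + y + z)"
    by (simp add: algebra_simps power2_eq_square)
  then show ?thesis using assms by simp
qed

lemma eigenvector3:
  fixes A :: "'a::field m3"
  assumes "a ^ 3 - tr3 A * a ^ 2 + q3 A * a - det3 A = 0"
  obtains v where "v \<noteq> (\<lambda>i. 0)" "app3 A v = (\<lambda>i. a * v i)"
proof -
  have "det3 (\<lambda>i j. A i j - a * one3 i j) = - (a ^ 3 - tr3 A * a ^ 2 + q3 A * a - det3 A)"
    by (simp add: det3_def tr3_def q3_def one3_def algebra_simps power2_eq_square power3_eq_cube)
  with assms have "det3 (\<lambda>i j. A i j - a * one3 i j) = 0" by simp
  then obtain v where v: "v \<noteq> (\<lambda>i. 0)" "\<And>i. (\<Sum>j\<in>UNIV. (A i j - a * one3 i j) * v j) = 0"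
    using kernel3 by blast
  have "app3 A v i = a * v i" for i
    using v(2)[of i] by (cases i rule: exhaust_3) (simp_all add: app3_def one3_def sum_3 algebra_simps)
  with v(1) that show thesis by auto
qed

lemma distinct_eigenvalues_diagonalizable:
  fixes A :: "'a::field m3"
  assumes A: "tr3 A = a + b + c" "q3 A = a * b + a * c + b * c" "det3 A = a * b * c"
    and distinct: "a \<noteq> b" "a \<noteq> c" "b \<noteq> c"
  obtains S where "det3 S \<noteq> 0"
    "mult3 A S = mult3 S (\<lambda>i j. if i = j then (if i = 0 then a else if i = 1 then b else c) else 0)"
proof -
  have char: "t ^ 3 - tr3 A * t ^ 2 + q3 A * t - det3 A = (t - a) * (t - b) * (t - c)" for t
    unfolding A by (simp add: algebra_simps power2_eq_square power3_eq_cube)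
  obtain x where x: "x \<noteq> (\<lambda>i. 0)" "app3 A x = (\<lambda>i. a * x i)" using eigenvector3[of a A] char by auto
  obtain y where y: "y \<noteq> (\<lambda>i. 0)" "app3 A y = (\<lambda>i. b * y i)" using eigenvector3[of b A] char by auto
  obtain z where z: "z \<noteq> (\<lambda>i. 0)" "app3 A z = (\<lambda>i. c * z i)" using eigenvector3[of c A] char by auto
  show thesis
  proof (rule that[of "cols3 x y z"])
    show "det3 (cols3 x y z) \<noteq> 0"
    proof (rule det3_cols3_nonzero)
      fix p q r
      assume 0: "\<And>i. p * x i + q * y i + r * z i = 0"
      \<comment> \<open>Applying \<open>A\<close> once and twice weights the terms of the relation
        by the eigenvalues and their squares, so each coordinate satisfies a Vandermonde
        system.\<close>
      have 1: "a * (p * x i) + b * (q * y i) + c * (r * z i) = 0" for i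
        using app3_comb[of p x q y r z A i, OF 0] by (simp add: x y z algebra_simps)
      have "p * a * x i + q * b * y i + r * c * z i = 0" for i
        using 1[of i] by (simp add: algebra_simps)
      from app3_comb[of "p * a" x "q * b" y "r * c" z A, OF this]
      have 2: "a\<^sup>2 * (p * x i) + b\<^sup>2 * (q * y i) + c\<^sup>2 * (r * z i) = 0" for i
        by (simp add: x y z algebra_simps power2_eq_square)
      have "p * x i = 0" for i
        using vandermonde3[OF 0[of i] 1[of i] 2[of i]] distinct by blast
      moreover have "q * y i = 0" for i
        using vandermonde3[of "q * y i" "p * x i" "r * z i" b a c] 0[of i] 1[of i] 2[of i] distinct
        by (simp add: add_ac)
      moreover have "r * z i = 0" for i
        using vandermonde3[of "r * z i" "p * x i" "q * y i" c a b] 0[of i] 1[of i] 2[of i] distinct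
        by (simp add: add_ac)
      moreover obtain i j k where "x i \<noteq> 0" "y j \<noteq> 0" "z k \<noteq> 0" using x(1) y(1) z(1) by blast
      ultimately show "p = 0 \<and> q = 0 \<and> r = 0" by (metis mult_eq_0_iff)
    qed
    show "mult3 A (cols3 x y z) = mult3 (cols3 x y z)
      (\<lambda>i j. if i = j then (if i = 0 then a else if i = 1 then b else c) else 0)"
      unfolding mult3_cols3 x y z
      by (rule m3_eqI) (simp_all add: mult3_def cols3_def sum_3)
  qed
qed

lemma cayley_hamilton3:
  "mult3 A (mult3 A A) = (\<lambda>i j. tr3 A * mult3 A A i j - q3 A * A i j + det3 A * one3 i j)"
proof -
  have "mult3 A (adj3 A) i j = mult3 A (mult3 A A) i j - tr3 A * mult3 A A i j + q3 A * A i j" for i j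
  proof -
    have "mult3 A (adj3 A) i j
      = mult3 A (mult3 A A) i j - tr3 A * mult3 A A i j + q3 A * mult3 A one3 i j"
      unfolding adj3_eq mult3_def[of A "\<lambda>i j. _ i j"] mult3_def[of A "mult3 A A"] mult3_def[of A one3]
      by (simp add: sum_3 mult3_def[of A A] algebra_simps)
    then show ?thesis by simp
  qed
  then show ?thesis by (simp add: mult3_adj3 fun_eq_iff algebra_simps)
qed

lemma app3_mult3: "app3 A (app3 B v) = app3 (mult3 A B) v"
  by (simp add: app3_def mult3_def sum_3 algebra_simps)

text \<open>A vector \<open>v\<close> not killed by the square of \<open>A\<close> yields the Jordan
  basis \<open>A (A v)\<close>, \<open>A v\<close>, \<open>v\<close>, the cube being zero by
  Cayley-Hamilton. The condition \<open>i \<noteq> 2\<close> excludes the wrap-around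
  \<open>2 + 1 = 0\<close>.\<close>

lemma regular_nilpotent_similar:
  fixes A :: "'a::field m3"
  assumes nil: "tr3 A = 0" "q3 A = 0" "det3 A = 0" and "mult3 A A k l \<noteq> 0"
  obtains S where "det3 S \<noteq> 0" "mult3 A S = mult3 S (\<lambda>i j. if i \<noteq> 2 \<and> j = i + 1 then 1 else 0)"
proof -
  define v :: "3 \<Rightarrow> 'a" where "v = (\<lambda>i. if i = l then 1 else 0)"
  define y where "y = app3 A v"
  define x where "x = app3 A y"
  have xA: "x = app3 (mult3 A A) v" by (simp add: x_def y_def app3_mult3)
  have "x k = mult3 A A k l"
    unfolding xA by (cases l rule: exhaust_3) (simp_all add: app3_def v_def sum_3)
  then have xk: "x k \<noteq> 0" using assms(4) by simp
  have "app3 A x = app3 (mult3 A (mult3 A A)) v" by (simp add: xA app3_mult3)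
  then have Ax: "app3 A x = (\<lambda>i. 0)"
    unfolding cayley_hamilton3 nil by (simp add: app3_def)
  show thesis
  proof (rule that[of "cols3 x y v"])
    show "det3 (cols3 x y v) \<noteq> 0"
    proof (rule det3_cols3_nonzero)
      fix p q r
      assume 0: "\<And>i. p * x i + q * y i + r * v i = 0"
      have 1: "0 * y i + q * x i + r * y i = 0" for i
        using app3_comb[of p x q y r v A i, OF 0] by (simp add: Ax x_def[symmetric] y_def[symmetric])
      have 2: "r * x i = 0" for i
        using app3_comb[of 0 y q x r y A i, OF 1] by (simp add: Ax x_def[symmetric] y_def[symmetric])
      with xk have r: "r = 0" using mult_eq_0_iff by blast
      with 1[of k] xk have q: "q = 0" by simp
      with 0[of k] r xk show "p = 0 \<and> q = 0 \<and> r = 0" by simp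
    qed
    show "mult3 A (cols3 x y v) = mult3 (cols3 x y v) (\<lambda>i j. if i \<noteq> 2 \<and> j = i + 1 then 1 else 0)"
      unfolding mult3_cols3 Ax x_def[symmetric] y_def[symmetric]
      by (rule m3_eqI) (simp_all add: mult3_def cols3_def sum_3)
  qed
qed

text \<open>The adjugate vanishes, so \<open>A\<close> has rank one. A nonzero column
  \<open>x\<close>, a preimage \<open>y\<close> of it and a further kernel vector \<open>z\<close>
  form a Jordan basis.\<close>

lemma square_zero_similar:
  fixes A :: "'a::field m3"
  assumes nil: "tr3 A = 0" "q3 A = 0" and sq: "\<And>i j. mult3 A A i j = 0" and nz: "A \<noteq> (\<lambda>i j. 0)"
  obtains S where "det3 S \<noteq> 0" "mult3 A S = mult3 S (unit3 0 1)"
proof -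
  have "adj3 A i j = 0" for i j unfolding adj3_eq nil by (simp add: sq)
  then have adj: "A (j + 1) (i + 1) * A (j + 2) (i + 2) = A (j + 1) (i + 2) * A (j + 2) (i + 1)" for i j
    by (simp add: adj3_def)
  have minors: "A i j * A k l = A i l * A k j" for i j k l
    using adj[of 0 0] adj[of 0 1] adj[of 0 2] adj[of 1 0] adj[of 1 1] adj[of 1 2]
      adj[of 2 0] adj[of 2 1] adj[of 2 2]
    by (cases i rule: exhaust_3; cases j rule: exhaust_3; cases k rule: exhaust_3; cases l rule: exhaust_3)
      (simp_all add: mult.commute)
  have "\<exists>i j. i \<noteq> j \<and> A i j \<noteq> 0"
  proof (rule ccontr)
    assume "\<nexists>i j. i \<noteq> j \<and> A i j \<noteq> 0"
    then have off: "A i j = 0" if "i \<noteq> j" for i j using that by blast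
    have "A i i = 0" for i
      using sq[of i i] by (cases i rule: exhaust_3) (simp_all add: mult3_def sum_3 off)
    with off have "A i j = 0" for i j by (cases "i = j") auto
    with nz show False by auto
  qed
  then obtain k l where kl: "k \<noteq> l" "A k l \<noteq> 0" by blast
  \<comment> \<open>The third index: the elements of Z/3 sum to zero and 2 = -1.\<close>
  define h where "h = 2 * k + 2 * l"
  define x where "x = (\<lambda>i. A i l)"
  define y where "y = (\<lambda>i. if i = l then 1 else 0 :: 'a)"
  \<comment> \<open>The coordinate \<open>l\<close> is chosen so that row \<open>k\<close> of
    \<open>A\<close> kills \<open>z\<close>; the vanishing minors extend this to all rows.\<close>
  define z where "z = (\<lambda>i. if i = h then 1 else if i = l then - A k h / A k l else 0)"
  have Ax: "app3 A x = (\<lambda>i. 0)"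
    using sq by (simp add: app3_def x_def mult3_def)
  have Ay: "app3 A y = x"
    by (cases l rule: exhaust_3) (simp_all add: app3_def x_def y_def sum_3)
  have "h \<noteq> l \<and> h \<noteq> k"
    using kl(1) unfolding h_def by (cases k rule: exhaust_3; cases l rule: exhaust_3) simp_all
  then have hl: "h \<noteq> l" "h \<noteq> k" by blast+
  have Az: "app3 A z i = A i h - A k h / A k l * A i l" for i
    using hl(1) by (cases h rule: exhaust_3; cases l rule: exhaust_3) (simp_all add: app3_def z_def sum_3)
  have "A k h / A k l * A i l = A i h" for i
    using minors[of i h k l] kl(2) by (simp add: field_simps)
  then have Az: "app3 A z = (\<lambda>i. 0)" by (intro ext) (simp only: Az diff_self)
  show thesis
  proof (rule that[of "cols3 x y z"])
    show "det3 (cols3 x y z) \<noteq> 0"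
    proof -
      have "z h = 1" "z k = 0" "x k \<noteq> 0" "y l = 1" "\<And>i. i \<noteq> l \<Longrightarrow> y i = 0"
        using kl hl by (simp_all add: x_def y_def z_def)
      with kl(1) show ?thesis
        unfolding h_def
        by (cases k rule: exhaust_3; cases l rule: exhaust_3) (simp_all add: det3_def cols3_def)
    qed
    show "mult3 A (cols3 x y z) = mult3 (cols3 x y z) (unit3 0 1)"
      unfolding mult3_cols3 Ax Ay Az
      by (rule m3_eqI) (simp_all add: mult3_def cols3_def unit3_def sum_3)
  qed
qed

section \<open>The classification\<close>

lemma eps3_cases: "if (3::'a::alg_closed_field) \<noteq> 0 then (eps3::'a) ^ 3 = 1 \<and> (eps3::'a) \<noteq> 1 else (eps3::'a) = 1"
proof (cases "(3::'a) = 0")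
  case False
  have "degree [:1, 1, 1 :: 'a:] > 0" by simp
  then obtain e :: 'a where "poly [:1, 1, 1:] e = 0" using alg_closed_imp_poly_has_root by blast
  then have e: "1 + e + e\<^sup>2 = 0" by (simp add: algebra_simps power2_eq_square)
  have "e ^ 3 - 1 = (e - 1) * (1 + e + e\<^sup>2)"
    by (simp add: algebra_simps power2_eq_square power3_eq_cube)
  with e have "e ^ 3 = 1" by simp
  \<comment> \<open>For \<open>e = 1\<close> the quadratic equation would read 3 = 0.\<close>
  moreover have "e \<noteq> 1" using e False by auto
  ultimately have "(eps3::'a) ^ 3 = 1 \<and> (eps3::'a) \<noteq> 1"
    unfolding eps3_def using False by (simp only: if_True not_False_eq_True) (rule someI, blast)
  then show ?thesis using False by simp
qed (simp add: eps3_def)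

lemma eps3_sum: "1 + eps3 + eps3\<^sup>2 = (0::'a::alg_closed_field)"
proof (cases "(3::'a) = 0")
  case True
  then show ?thesis using eps3_cases[where 'a = 'a] by simp
next
  case False
  have "(eps3 - 1) * (1 + eps3 + eps3\<^sup>2) = (eps3 :: 'a) ^ 3 - 1"
    by (simp add: algebra_simps power2_eq_square power3_eq_cube)
  then show ?thesis using eps3_cases[where 'a = 'a] False by auto
qed

lemma eps3_cube: "eps3 ^ 3 = (1::'a::alg_closed_field)"
  using eps3_cases[where 'a = 'a] by (auto split: if_splits)

lemma three_scalar_symmetric_functions:
  fixes t :: "'a::alg_closed_field"
  shows "t + t * eps3 + t * eps3\<^sup>2 = 0"
    and "t * (t * eps3) + t * (t * eps3\<^sup>2) + t * eps3 * (t * eps3\<^sup>2) = 0"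
    and "t * (t * eps3) * (t * eps3\<^sup>2) = t ^ 3"
proof -
  have "t + t * eps3 + t * eps3\<^sup>2 = t * (1 + eps3 + eps3\<^sup>2)" by (simp add: algebra_simps)
  then show "t + t * eps3 + t * eps3\<^sup>2 = 0" by (simp add: eps3_sum)
  have "t * (t * eps3) + t * (t * eps3\<^sup>2) + t * eps3 * (t * eps3\<^sup>2)
    = t\<^sup>2 * eps3 * (1 + eps3 + eps3\<^sup>2)"
    by (simp add: algebra_simps power2_eq_square)
  then show "t * (t * eps3) + t * (t * eps3\<^sup>2) + t * eps3 * (t * eps3\<^sup>2) = 0"
    by (simp add: eps3_sum)
  have "t * (t * eps3) * (t * eps3\<^sup>2) = t ^ 3 * eps3 ^ 3"
    by (simp add: algebra_simps power2_eq_square power3_eq_cube)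
  then show "t * (t * eps3) * (t * eps3\<^sup>2) = t ^ 3" by (simp add: eps3_cube)
qed

text \<open>The symmetric functions of the three eigenvalues are 0, 0 and the cube of \<gamma>;
  every determinant has a cube root, in characteristic 3 as well.\<close>

lemma three_scalar_to_mat3:
  fixes A :: "'a::alg_closed_field m3"
  shows "three_scalar (to_mat3 A) \<longleftrightarrow> tr3 A = 0 \<and> q3 A = 0"
proof -
  obtain t where "t ^ 3 = det3 A" using nth_root_exists[of 3 "det3 A"] by auto
  then show ?thesis
    unfolding three_scalar_def has_eigenvalues3_to_mat3 three_scalar_symmetric_functions
    by (auto intro: exI[of _ t])
qed

text \<open>Conjugating a multiple of the unit at (0, 1) makes the functional
  \<open>A 0 0 - A 1 1\<close> nonzero, and passing to matrix units makes the value diagonal. For a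
  traceless diagonal matrix in characteristic 3, \<open>q3\<close> is minus the square of that
  difference.\<close>

lemma ev3_q3_nonzero_char_3:
  fixes c :: "(nat \<Rightarrow> nat) \<Rightarrow> 'a::alg_closed_field"
  assumes three: "(3::'a) = 0"
    and tr: "\<And>X. tr3 (ev3 m c X) = 0"
    and u: "ev3 m c (\<lambda>k. unit3 (r k) (s k)) 0 1 \<noteq> 0"
  shows "\<exists>X. q3 (ev3 m c X) \<noteq> 0"
proof -
  define e where "e = ev3 m c (\<lambda>k. unit3 (r k) (s k)) 0 1"
  have ev_u: "ev3 m c (\<lambda>k. unit3 (r k) (s k)) = (\<lambda>i j. if i = 0 \<and> j = 1 then e else 0)"
    by (rule m3_eqI) (simp_all add: e_def ev3_unit_tuple_offdiag[OF u])
  have "(1::3) \<noteq> 0" by simp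
  then obtain Y where "ev3 m c Y = conj3 (\<lambda>a b. one3 a b + unit3 1 0 a b)
      (\<lambda>a b. one3 a b - unit3 1 0 a b) (ev3 m c (\<lambda>k. unit3 (r k) (s k)))"
    by (rule ev3_conj_transvection[THEN exE])
  then have "ev3 m c Y 0 0 - ev3 m c Y 1 1 = - (2 * e)"
    unfolding ev_u by (simp add: conj3_def mult3_def one3_def unit3_def sum_3)
  moreover have "(2::'a) = - 1" using three by (simp add: eq_neg_iff_add_eq_0)
  ultimately have nz: "ev3 m c Y 0 0 - ev3 m c Y 1 1 \<noteq> 0"
    using u by (simp only: e_def) simp
  obtain r' s' where w: "ev3 m c (\<lambda>k. unit3 (r' k) (s' k)) 0 0
      - ev3 m c (\<lambda>k. unit3 (r' k) (s' k)) 1 1 \<noteq> 0"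
    using ev3_unit_tuple[of "\<lambda>A. A 0 0 - A 1 1", OF _ nz] by (auto simp: algebra_simps)
  define W where "W = ev3 m c (\<lambda>k. unit3 (r' k) (s' k))"
  from w have "W 0 0 \<noteq> 0 \<or> W 1 1 \<noteq> 0" unfolding W_def by auto
  then have off: "W i j = 0" if "i \<noteq> j" for i j
    using that ev3_unit_tuple_diag unfolding W_def by metis
  have W22: "W 2 2 = - (W 0 0 + W 1 1)"
    using tr[of "\<lambda>k. unit3 (r' k) (s' k)"] unfolding W_def tr3_def by (rule minus_unique[symmetric])
  have "q3 W = - ((W 0 0 - W 1 1)\<^sup>2) - 3 * (W 0 0 * W 1 1)"
    unfolding q3_def W22 by (simp add: off algebra_simps power2_eq_square)
  with w three have "q3 W \<noteq> 0" by (simp add: W_def)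
  then show ?thesis by (intro exI[of _ "\<lambda>k. unit3 (r' k) (s' k)"]) (simp only: W_def not_False_eq_True)
qed

text \<open>Outside characteristic 3 a matrix with these invariants and nonzero determinant has
  distinct eigenvalues, so the determinant fixes its similarity class. The remaining ones are
  nilpotent: regular, similar to the unit at (0, 1), or zero. Each class contains a value.\<close>

lemma ev3_range_three_scalar:
  fixes c :: "(nat \<Rightarrow> nat) \<Rightarrow> 'a::alg_closed_field"
  assumes m: "m \<ge> 1" and three: "(3::'a) \<noteq> 0"
    and tr: "\<And>X. tr3 (ev3 m c X) = 0" and q: "\<And>X. q3 (ev3 m c X) = 0"
    and u: "ev3 m c (\<lambda>k. unit3 (r k) (s k)) 0 1 \<noteq> 0"
  shows "range (ev3 m c) = {A. tr3 A = 0 \<and> q3 A = 0}"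
proof -
  have scaled: "(\<lambda>i j. t * ev3 m c X i j) \<in> range (ev3 m c)" for t X
    by (rule range_eqI) (rule ev3_scale[OF m, symmetric])
  have "A \<in> range (ev3 m c)" if A: "tr3 A = 0" "q3 A = 0" for A
  proof (cases "det3 A = 0")
    case False
    obtain t where t: "t ^ 3 = det3 A" using nth_root_exists[of 3 "det3 A"] by auto
    with False have "t \<noteq> 0" by auto
    define D :: "'a m3" where
      "D = (\<lambda>i j. if i = j then (if i = 0 then t else if i = 1 then t * eps3 else t * eps3\<^sup>2) else 0)"
    have eps: "eps3 \<noteq> (1::'a)" "eps3 \<noteq> (0::'a)" "eps3 * eps3\<^sup>2 = (1::'a)"
      using eps3_cases[where 'a = 'a] three
      by (auto simp: power2_eq_square power3_eq_cube mult.assoc)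
    then have "eps3\<^sup>2 \<noteq> (1::'a)" by auto
    with eps \<open>t \<noteq> 0\<close> have distinct: "t \<noteq> t * eps3" "t \<noteq> t * eps3\<^sup>2" "t * eps3 \<noteq> t * eps3\<^sup>2"
      by (auto simp: power2_eq_square)
    have D: "B \<in> range (ev3 m c) \<longleftrightarrow> D \<in> range (ev3 m c)" if B: "tr3 B = 0" "q3 B = 0" "det3 B = t ^ 3" for B
    proof -
      have "tr3 B = t + t * eps3 + t * eps3\<^sup>2"
        "q3 B = t * (t * eps3) + t * (t * eps3\<^sup>2) + t * eps3 * (t * eps3\<^sup>2)"
        "det3 B = t * (t * eps3) * (t * eps3\<^sup>2)"
        unfolding three_scalar_symmetric_functions by (rule B)+
      from distinct_eigenvalues_diagonalizable[OF this distinct]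
      obtain S where "det3 S \<noteq> 0" "mult3 B S = mult3 S D" unfolding D_def .
      then show ?thesis by (intro ev3_range_similar)
    qed
    obtain V where V: "\<And>i j. j \<noteq> i + 1 \<Longrightarrow> ev3 m c V i j = 0" "\<And>i. ev3 m c V i (i + 1) \<noteq> 0"
      using graded_invertible[OF u] by metis
    have V_det: "det3 (ev3 m c V) \<noteq> 0"
      using graded_q3_det3[OF V(1)] V(2)[of 0] V(2)[of 1] V(2)[of 2] by simp
    \<comment> \<open>Scaling adjusts the nonzero determinant of the graded value to the required
      one.\<close>
    obtain s where s: "s ^ 3 = t ^ 3 / det3 (ev3 m c V)"
      using nth_root_exists[of 3 "t ^ 3 / det3 (ev3 m c V)"] by auto
    define B where "B = (\<lambda>i j. s * ev3 m c V i j)"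
    have "B \<in> range (ev3 m c)" unfolding B_def by (rule scaled)
    moreover from this have "tr3 B = 0" "q3 B = 0" using tr q by auto
    moreover have "det3 B = t ^ 3" unfolding B_def det3_scale s using V_det by simp
    ultimately show ?thesis using D[of A] D[of B] A t by simp
  next
    case nil: True
    show ?thesis
    proof (cases "\<exists>i j. mult3 A A i j \<noteq> 0")
      case True
      define J :: "'a m3" where "J = (\<lambda>i j. if i \<noteq> 2 \<and> j = i + 1 then 1 else 0)"
      have J: "B \<in> range (ev3 m c) \<longleftrightarrow> J \<in> range (ev3 m c)"
        if B: "tr3 B = 0" "q3 B = 0" "det3 B = 0" "mult3 B B i j \<noteq> 0" for B i j
      proof -
        obtain S where "det3 S \<noteq> 0" "mult3 B S = mult3 S J"
          using regular_nilpotent_similar[OF B] unfolding J_def .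
        then show ?thesis by (intro ev3_range_similar)
      qed
      obtain k Z where k: "k < m"
        and Z: "\<And>i j. j \<noteq> i + 1 \<Longrightarrow> ev3 m c Z i j = 0"
        and Z': "\<And>i j. j \<noteq> i + 1 \<Longrightarrow> ev3 m c (Z(k := Z m)) i j = 0"
        and \<Delta>: "\<And>i. ev3 m c Z i (i + 1) * ev3 m c (Z(k := Z m)) (i + 1) (i + 2)
         - ev3 m c (Z(k := Z m)) i (i + 1) * ev3 m c Z (i + 1) (i + 2) \<noteq> 0"
        using graded_pair[OF u] by blast
      define P where "P = ev3 m c Z"
      define R where "R = ev3 m c (Z(k := Z m))"
      \<comment> \<open>The combination cancels the entry (2, 0), while nonproportionality keeps the
        entries (0, 1) and (1, 2) nonzero; the result is regular nilpotent.\<close>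
      define B where "B = (\<lambda>i j. R 2 0 * P i j + (- P 2 0) * R i j)"
      have "B = ev3 m c (Z(k := \<lambda>i j. R 2 0 * Z k i j + (- P 2 0) * Z m i j))"
        using ev3_linear[OF k, of c Z "R 2 0" "Z k" "- P 2 0" "Z m"]
        unfolding B_def P_def R_def by (intro ext) simp
      then have B: "B \<in> range (ev3 m c)" by (rule range_eqI[of B "ev3 m c"])
      then have "tr3 B = 0" "q3 B = 0" using tr q by auto
      moreover have B0: "B i j = 0" if "j \<noteq> i + 1" for i j
        using Z[OF that] Z'[OF that] by (simp add: B_def P_def R_def)
      have "B 2 0 = 0" by (simp add: B_def algebra_simps)
      then have "det3 B = 0" using graded_q3_det3(2)[of B, OF B0] by simp
      moreover have "B 0 1 \<noteq> 0" "B 1 2 \<noteq> 0"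
        using \<Delta>[of 2] \<Delta>[of 1] by (simp_all add: B_def P_def R_def algebra_simps)
      then have "mult3 B B 0 2 \<noteq> 0" by (simp add: mult3_def sum_3 B0)
      ultimately have "J \<in> range (ev3 m c)" using J B by blast
      moreover obtain i j where "mult3 A A i j \<noteq> 0" using True by blast
      ultimately show ?thesis using J A nil by blast
    next
      case False
      then have sq: "\<And>i j. mult3 A A i j = 0" by blast
      define U where "U = ev3 m c (\<lambda>k. unit3 (r k) (s k))"
      have "U 0 1 \<noteq> 0" "\<And>i j. (i, j) \<noteq> (0, 1) \<Longrightarrow> U i j = 0"
        unfolding U_def using u ev3_unit_tuple_offdiag[OF u] by blast+
      then have unit: "unit3 0 1 = (\<lambda>i j. inverse (U 0 1) * U i j)"
        by (intro m3_eqI) (simp_all add: unit3_def)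
      have U: "unit3 0 1 \<in> range (ev3 m c)"
        unfolding unit U_def by (rule scaled)
      show ?thesis
      proof (cases "A = (\<lambda>i j. 0)")
        case True
        then show ?thesis using scaled[of 0 "\<lambda>k. one3"] by simp
      next
        case False
        obtain S where "det3 S \<noteq> 0" "mult3 A S = mult3 S (unit3 0 1)"
          using square_zero_similar[OF A sq False] .
        with U show ?thesis using ev3_range_similar by blast
      qed
    qed
  qed
  with tr q show ?thesis by auto
qed

theorem theorem1p13:
  fixes c :: "(nat \<Rightarrow> nat) \<Rightarrow> 'a::alg_closed_field"
    and m :: nat
  assumes "m \<ge> 1"
    and "trace_vanishing 3 m c"
  shows "ml_image 3 m c = {0\<^sub>m 3 3}
      \<or> ml_image 3 m c = {a \<cdot>\<^sub>m 1\<^sub>m 3 | a. True}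
      \<or> ml_image 3 m c = {A. three_scalar A}
      \<or> (\<forall>l1 l2 l3. l1 + l2 + l3 = 0 \<longrightarrow>
           (\<exists>M\<in>ml_image 3 m c. has_eigenvalues3 M l1 l2 l3))"
proof -
  have tr: "tr3 (ev3 m c X) = 0" for X
    using assms(2) by (simp add: trace_vanishing_def ml_image_eq mat_trace_to_mat3)
  show ?thesis
  proof (cases "\<forall>X. \<exists>a. ev3 m c X = (\<lambda>i j. a * one3 i j)")
    case True
    have scalar: "to_mat3 (\<lambda>i j. a * one3 i j) = a \<cdot>\<^sub>m 1\<^sub>m 3" for a :: 'a
      by (rule eq_matI) (auto simp: to_mat3_def one3_def less_3_cases)
    have sub: "ml_image 3 m c \<subseteq> {a \<cdot>\<^sub>m 1\<^sub>m 3 | a. True}"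
    proof
      fix M assume "M \<in> ml_image 3 m c"
      then obtain X where X: "M = to_mat3 (ev3 m c X)" unfolding ml_image_eq by blast
      obtain a where "ev3 m c X = (\<lambda>i j. a * one3 i j)" using True by blast
      then show "M \<in> {a \<cdot>\<^sub>m 1\<^sub>m 3 | a. True}" using X scalar by auto
    qed
    \<comment> \<open>Closure under scaling turns a single nonzero scalar value into all scalar
      matrices.\<close>
    have mult: "t \<cdot>\<^sub>m M \<in> ml_image 3 m c" if M: "M \<in> ml_image 3 m c" for t M
    proof -
      obtain X where X: "M = to_mat3 (ev3 m c X)" using M unfolding ml_image_eq by blast
      have "t \<cdot>\<^sub>m M = to_mat3 (ev3 m c (X(0 := \<lambda>i j. t * X 0 i j)))"
        unfolding X ev3_scale[OF assms(1)] by (rule eq_matI) (auto simp: to_mat3_def)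
      then show ?thesis unfolding ml_image_eq by blast
    qed
    have ne: "to_mat3 (ev3 m c (\<lambda>k. one3)) \<in> ml_image 3 m c" unfolding ml_image_eq by blast
    show ?thesis
    proof (cases "ml_image 3 m c \<subseteq> {0\<^sub>m 3 3}")
      case True
      then have "ml_image 3 m c = {0\<^sub>m 3 3}" using ne by (auto dest: subset_singletonD)
      then show ?thesis ..
    next
      case False
      then obtain a where a: "a \<cdot>\<^sub>m 1\<^sub>m 3 \<in> ml_image 3 m c" "a \<cdot>\<^sub>m 1\<^sub>m 3 \<noteq> 0\<^sub>m 3 3"
        using sub by blast
      then have "a \<noteq> 0" by auto
      have "b \<cdot>\<^sub>m 1\<^sub>m 3 \<in> ml_image 3 m c" for b
      proof -
        have "b \<cdot>\<^sub>m 1\<^sub>m 3 = (b / a) \<cdot>\<^sub>m (a \<cdot>\<^sub>m 1\<^sub>m 3 :: 'a mat)"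
          using \<open>a \<noteq> 0\<close> by (intro eq_matI) auto
        with mult[OF a(1)] show ?thesis by metis
      qed
      with sub have "ml_image 3 m c = {a \<cdot>\<^sub>m 1\<^sub>m 3 | a. True}" by blast
      then show ?thesis by blast
    qed
  next
    case False
    then obtain X0 where "\<nexists>a. ev3 m c X0 = (\<lambda>i j. a * one3 i j)" by blast
    from ev3_nonscalar[OF this] obtain X1 where X1: "ev3 m c X1 0 1 \<noteq> 0" by blast
    obtain r s where u: "ev3 m c (\<lambda>k. unit3 (r k) (s k)) 0 1 \<noteq> 0"
      using ev3_unit_tuple[of "\<lambda>A. A 0 1", OF _ X1] by auto
    show ?thesis
    proof (cases "\<exists>X. q3 (ev3 m c X) \<noteq> 0")
      case True
      then obtain X2 where X2: "q3 (ev3 m c X2) \<noteq> 0" by blast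
      have "\<exists>M\<in>ml_image 3 m c. has_eigenvalues3 M l1 l2 l3" if l: "l1 + l2 + l3 = 0" for l1 l2 l3
      proof -
        obtain X where "q3 (ev3 m c X) = l1 * l2 + l1 * l3 + l2 * l3"
          "det3 (ev3 m c X) = l1 * l2 * l3"
          using ev3_q3_det3_surj[OF assms(1) u X2] by blast
        then have "has_eigenvalues3 (to_mat3 (ev3 m c X)) l1 l2 l3"
          unfolding has_eigenvalues3_to_mat3 using tr[of X] l by simp
        then show ?thesis unfolding ml_image_eq by blast
      qed
      then show ?thesis by blast
    next
      case no_q: False
      \<comment> \<open>In characteristic 3 some value would have nonzero \<open>q3\<close>.\<close>
      then have "(3::'a) \<noteq> 0" using ev3_q3_nonzero_char_3[OF _ tr u] by blast
      then have range: "range (ev3 m c) = {A. tr3 A = 0 \<and> q3 A = 0}"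
        using ev3_range_three_scalar[OF assms(1) _ tr _ u] no_q by blast
      have "ml_image 3 m c = {A. three_scalar A}"
      proof (intro equalityI subsetI)
        fix M assume "M \<in> ml_image 3 m c"
        then show "M \<in> {A. three_scalar A}"
          unfolding ml_image_eq range by (auto simp: three_scalar_to_mat3)
      next
        fix M :: "'a mat" assume M: "M \<in> {A. three_scalar A}"
        then have "M \<in> carrier_mat 3 3" by (simp add: three_scalar_def)
        then obtain A where A: "M = to_mat3 A" by (rule to_mat3_surj)
        with M show "M \<in> ml_image 3 m c"
          unfolding ml_image_eq range by (auto simp: three_scalar_to_mat3)
      qed
      then show ?thesis by blast
    qed
  qed
qed

end
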